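(* Let $\mathbb{E}:\mathbb{M}_n\to\mathbb{M}_m$ be a sub-unital positive linear map, let $f$ be a doubly concave function on an interval $\Omega\subset[0,\infty)$, where $0\in\Omega$ if $\mathbb{E}$ is not unital, let $Z\in\mathbb{M}_n\{\Omega\}$ and let $p\in(0,1]$. Then $$f(\mathbb{E}_p(Z))\prec^{w(\log)}\mathbb{E}_p(f(Z)).$$ If furthermore $f$ is monotone, then, for some unitary $V\in\mathbb{M}_m$, $$f(\mathbb{E}_p(Z))\ge V\,\mathbb{E}_p(f(Z))\,V^*.$$ Moreover, when $\mathbb{E}$ is unital and both $Z$ and $f(Z)$ are invertible, one also has $$f(\mathbb{E}_0(Z))\prec^{w(\log)}\mathbb{E}_0(f(Z)),$$ and, if furthermore $f$ is monotone, then, for some unitary $V\in\mathbb{M}_m$, $$f(\mathbb{E}_0(Z))\ge V\,\mathbb{E}_0(f(Z))\,V^*.$$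
   Context: $\mathbb{M}_n$ is the algebra of $n\times n$ complex matrices, $\mathbb{M}_n\{\Omega\}$ the set of Hermitian matrices with spectrum in $\Omega$, $\mathbb{M}_n^+=\mathbb{M}_n\{[0,\infty)\}$. A positive linear map $\mathbb{E}:\mathbb{M}_n\to\mathbb{M}_m$ is unital if $\mathbb{E}(I)=I$ and sub-unital if $\mathbb{E}(I)\le I$. For $Z\in\mathbb{M}_n^+$ and $p\in(0,1]$, $\mathbb{E}_p(Z):=(\mathbb{E}(Z^p))^{1/p}$; for $\mathbb{E}$ unital and $Z\in\mathbb{M}_n^+$ invertible, $\mathbb{E}_0(Z):=\lim_{p\searrow0}\mathbb{E}_p(Z)=\exp\mathbb{E}(\log Z)$. A function $f$ on an interval $\Omega\subset[0,\infty)$ is doubly concave if it is non-negative, continuous, concave, and geometrically concave, i.e. $f(\sqrt{xy})\ge\sqrt{f(x)f(y)}$ for all $x,y\in\Omega$. Matrices $f(\cdot)$ are defined by functional calculus and $\ge$ is the Loewner order. For $A,B\in\mathbb{M}_m^+$ with eigenvalues $\lambda_1\ge\dots\ge\lambda_m$ in decreasing order with multiplicities, $A\prec^{w(\log)}B$ means $\prod_{j=1}^k\lambda_{m+1-j}(A)\ge\prod_{j=1}^k\lambda_{m+1-j}(B)$ for $k=1,\dots,m$. *)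

theory Defs
  imports "HOL-Analysis.Analysis" "Jordan_Normal_Form.Spectral_Radius"
begin

definition hermitian_mats :: "nat \<Rightarrow> real set \<Rightarrow> complex mat set" where
  "hermitian_mats n \<Omega> =
     {A \<in> carrier_mat n n. mat_adjoint A = A \<and> spectrum A \<subseteq> complex_of_real ` \<Omega>}"

abbreviation psd_mats :: "nat \<Rightarrow> complex mat set" where
  "psd_mats n \<equiv> hermitian_mats n {0..}"

definition loewner_le :: "nat \<Rightarrow> complex mat \<Rightarrow> complex mat \<Rightarrow> bool" where
  "loewner_le n A B \<longleftrightarrow>
     A \<in> carrier_mat n n \<and> B \<in> carrier_mat n n \<and> B - A \<in> psd_mats n"

definition unitary_mat :: "nat \<Rightarrow> complex mat \<Rightarrow> bool" where
  "unitary_mat n U \<longleftrightarrow>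
     U \<in> carrier_mat n n \<and> U * mat_adjoint U = 1\<^sub>m n \<and> mat_adjoint U * U = 1\<^sub>m n"

text \<open>Functional calculus on Hermitian matrices: \<open>f(A) = U diag(f(d\<^sub>i)) U*\<close> for any
  diagonalisation \<open>A = U diag(d\<^sub>i) U*\<close> with \<open>U\<close> unitary and \<open>d\<close> real; the result does
  not depend on the diagonalisation chosen.  Only the values of \<open>f\<close> on the spectrum
  matter.\<close>

definition mat_fun :: "(real \<Rightarrow> real) \<Rightarrow> complex mat \<Rightarrow> complex mat" where
  "mat_fun f A = (let n = dim_row A in
     THE B. \<exists>U d. unitary_mat n U \<and>
       A = U * mat_diag n (\<lambda>i. complex_of_real (d i)) * mat_adjoint U \<and>
       B = U * mat_diag n (\<lambda>i. complex_of_real (f (d i))) * mat_adjoint U)"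

text \<open>Eigenvalues of a Hermitian matrix, repeated with their multiplicity as roots of the
  characteristic polynomial, in decreasing order and numbered from 1.\<close>

definition eig_desc :: "complex mat \<Rightarrow> real list" where
  "eig_desc A = rev (sorted_list_of_multiset (image_mset Re (proots (char_poly A))))"

definition eig :: "complex mat \<Rightarrow> nat \<Rightarrow> real" where
  "eig A j = eig_desc A ! (j - 1)"

definition wlog_major :: "nat \<Rightarrow> complex mat \<Rightarrow> complex mat \<Rightarrow> bool" where
  "wlog_major m A B \<longleftrightarrow> A \<in> psd_mats m \<and> B \<in> psd_mats m \<and>
     (\<forall>k\<in>{1..m}. (\<Prod>j=1..k. eig A (m + 1 - j)) \<ge> (\<Prod>j=1..k. eig B (m + 1 - j)))"

text \<open>Maps are constrained only on \<^term>\<open>carrier_mat n n\<close>.\<close>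

definition positive_linear_map ::
    "nat \<Rightarrow> nat \<Rightarrow> (complex mat \<Rightarrow> complex mat) \<Rightarrow> bool" where
  "positive_linear_map n m E \<longleftrightarrow>
     (\<forall>A\<in>carrier_mat n n. E A \<in> carrier_mat m m) \<and>
     (\<forall>A\<in>carrier_mat n n. \<forall>B\<in>carrier_mat n n. E (A + B) = E A + E B) \<and>
     (\<forall>c. \<forall>A\<in>carrier_mat n n. E (c \<cdot>\<^sub>m A) = c \<cdot>\<^sub>m E A) \<and>
     (\<forall>A\<in>psd_mats n. E A \<in> psd_mats m)"

definition unital_map :: "nat \<Rightarrow> nat \<Rightarrow> (complex mat \<Rightarrow> complex mat) \<Rightarrow> bool" where
  "unital_map n m E \<longleftrightarrow> E (1\<^sub>m n) = 1\<^sub>m m"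

definition sub_unital_map :: "nat \<Rightarrow> nat \<Rightarrow> (complex mat \<Rightarrow> complex mat) \<Rightarrow> bool" where
  "sub_unital_map n m E \<longleftrightarrow> loewner_le m (E (1\<^sub>m n)) (1\<^sub>m m)"

definition power_mean_map ::
    "(complex mat \<Rightarrow> complex mat) \<Rightarrow> real \<Rightarrow> complex mat \<Rightarrow> complex mat" where
  "power_mean_map E p Z =
     mat_fun (\<lambda>x. x powr (1 / p)) (E (mat_fun (\<lambda>x. x powr p) Z))"

text \<open>The type of matrices carries no topology, so the limit as \<open>p\<close> decreases to 0 of the
  \<open>m \<times> m\<close> matrices is taken entrywise.\<close>

definition geo_mean_map ::
    "nat \<Rightarrow> (complex mat \<Rightarrow> complex mat) \<Rightarrow> complex mat \<Rightarrow> complex mat" where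
  "geo_mean_map m E Z =
     Matrix.mat m m (\<lambda>(i, j). Lim (at_right 0) (\<lambda>p. power_mean_map E p Z $$ (i, j)))"

definition doubly_concave_on :: "real set \<Rightarrow> (real \<Rightarrow> real) \<Rightarrow> bool" where
  "doubly_concave_on \<Omega> f \<longleftrightarrow>
     (\<forall>x\<in>\<Omega>. f x \<ge> 0) \<and> continuous_on \<Omega> f \<and> concave_on \<Omega> f \<and>
     (\<forall>x\<in>\<Omega>. \<forall>y\<in>\<Omega>. f (sqrt (x * y)) \<ge> sqrt (f x * f y))"

end

theory Submission
  imports Defs
begin

text \<open>
  The operator statement follows from a scalar Jensen inequality applied to every unit vector.
  Let \<open>Z = \<Sum> z\<^sub>k P\<^sub>k\<close> be a spectral decomposition into rank one projections, and put
  \<open>w\<^sub>k(h) = \<langle>E(P\<^sub>k) h, h\<rangle>\<close>.  Positivity of \<open>E\<close> gives \<open>w\<^sub>k(h) \<ge> 0\<close>, and for a unit vector \<open>h\<close> the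
  total weight is at most 1, with equality when \<open>E\<close> is unital.  With \<open>\<psi>(t) = t powr (1/p)\<close>,
  \<open>X = E(Z powr p)\<close> and \<open>Y = E(f(Z) powr p)\<close>, the two quadratic forms at \<open>h\<close> are
  \<open>\<Sum> w\<^sub>k z\<^sub>k powr p\<close> and \<open>\<Sum> w\<^sub>k f(z\<^sub>k) powr p\<close>, so that the scalar inequality says
  \<open>\<psi>(\<langle>Y h, h\<rangle>) \<le> f(\<psi>(\<langle>X h, h\<rangle>))\<close>.  For the geometric mean the same scheme runs with \<open>\<psi> = exp\<close>,
  \<open>X = E(log Z)\<close> and \<open>Y = E(log f(Z))\<close>.

  The scalar inequality (\<open>doubly_concave_power_mean\<close>) asserts that \<open>f(t powr (1/p)) powr p\<close> is
  concave.  At an interior point \<open>c\<close> it suffices to bound \<open>f powr p\<close> by an affine function of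
  \<open>x powr p\<close> which touches it at \<open>c\<close> (\<open>doubly_concave_powr_supergradient\<close>).  Concavity alone
  provides this bound when the normalised slope of \<open>f\<close> at \<open>c\<close> lies outside \<open>(0, 1)\<close>; for slopes
  inside \<open>(0, 1)\<close> geometric concavity, that is concavity of \<open>log f\<close> in \<open>log x\<close>, takes over.
  A deficit in the total weight is placed at the point 0, which only increases the left-hand side
  since \<open>f(0) \<ge> 0\<close> (\<open>sub_unital_power_mean_jensen\<close>).

  An inequality between quadratic forms becomes one between eigenvalues in two ways
  (\<open>jensen_spectral_comparison\<close>).  Evaluating at the eigenvectors of \<open>X\<close> expresses the quadratic
  form of \<open>Y\<close> as a doubly stochastic average of the eigenvalues of \<open>Y\<close>; as \<open>log \<psi>\<close> is concave, and
  a weighted sum with weights in \<open>[0, 1]\<close> and total weight \<open>k\<close> is at least the sum of the \<open>k\<close>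
  smallest terms, the log-majorisation follows.  If \<open>f\<close> is monotone, evaluating at a common unit vector
  of a bottom spectral subspace of \<open>f(\<psi>(X))\<close> and a top spectral subspace of \<open>Y\<close>, as in the
  min-max principle, compares the eigenvalues one by one, and Hermitian matrices whose ordered
  eigenvalues are comparable are comparable up to unitary conjugation.

  The limit formula for the geometric mean (\<open>geo_mean_map_eq_exp_log\<close>) compares
  \<open>E(Z powr p) powr (1/p)\<close> with \<open>(1 + p E(log Z)) powr (1/p)\<close>.  Both are functions of Hermitian
  matrices, and a function with Lipschitz constant \<open>c\<close> on the spectra is Lipschitz with the same
  constant for the Frobenius norm; this reduces the question to the scalar limits
  \<open>(z powr p - 1) / p \<longlongrightarrow> log z\<close> and \<open>(1 + p t) powr (1/p) \<longlongrightarrow> exp t\<close>.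
\<close>

section \<open>Power means of doubly concave functions\<close>

text \<open>If the function fell below one of its chords, the difference to the chord would attain a negative
  minimum; the midpoint inequality fails around the leftmost point where it does.\<close>

lemma midpoint_concave_imp_concave:
  fixes g :: "real \<Rightarrow> real"
  assumes conv: "convex A" and cont: "continuous_on A g"
    and mid: "\<And>x y. x \<in> A \<Longrightarrow> y \<in> A \<Longrightarrow> (g x + g y) / 2 \<le> g ((x + y) / 2)"
  shows "concave_on A g"
proof (rule concave_on_linorderI[OF _ conv])
  fix t x y :: real
  assume t: "0 < t" "t < 1" and xy: "x \<in> A" "y \<in> A" "x < y"
  define seg where "seg s = (1 - s) * x + s * y" for s
  define h where "h s = g (seg s) - ((1 - s) * g x + s * g y)" for s
  have segA: "seg s \<in> A" if "s \<in> {0..1}" for s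
    using conv xy that unfolding seg_def convex_alt by auto
  have conth: "continuous_on {0..1} h"
    unfolding h_def using segA
    by (intro continuous_intros continuous_on_compose2[OF cont]) (auto simp: seg_def intro!: continuous_intros)
  have hmid: "(h a + h b) / 2 \<le> h ((a + b) / 2)" if "a \<in> {0..1}" "b \<in> {0..1}" for a b
  proof -
    have *: "seg ((a + b) / 2) = (seg a + seg b) / 2"
      unfolding seg_def by (simp add: field_simps)
    show ?thesis
      using mid[OF segA[OF that(1)] segA[OF that(2)]] unfolding h_def * by (simp add: field_simps)
  qed
  have "0 \<le> h t"
  proof (rule ccontr)
    assume neg: "\<not> 0 \<le> h t"
    obtain u where u: "u \<in> {0..1}" "\<And>s. s \<in> {0..1} \<Longrightarrow> h u \<le> h s"
      using continuous_attains_inf[OF compact_Icc _ conth] by fastforce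
    \<comment> \<open>the leftmost minimiser is interior, and contradicts the midpoint inequality around it\<close>
    have "closed ({0..1} \<inter> h -` {h u})"
      using conth by (intro continuous_closed_preimage) auto
    moreover have "bounded ({0..1} \<inter> h -` {h u})"
      by (rule bounded_subset[OF bounded_closed_interval]) auto
    ultimately have comp: "compact ({0..1} \<inter> h -` {h u})"
      by (simp add: compact_eq_bounded_closed)
    have "{0..1} \<inter> h -` {h u} \<noteq> {}" using u by auto
    from compact_attains_inf[OF comp this]
    obtain v where v: "v \<in> {0..1}" "h v = h u"
      "\<And>s. s \<in> {0..1} \<Longrightarrow> h s = h u \<Longrightarrow> v \<le> s" by auto
    have "h v < 0" using v u(2)[of t] t neg by auto
    moreover have "h 0 = 0" "h 1 = 0" by (auto simp: h_def seg_def)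
    ultimately have v01: "0 < v" "v < 1" using v(1) by (auto simp: less_le)
    define e where "e = min v (1 - v)"
    have e: "0 < e" "v - e \<in> {0..1}" "v + e \<in> {0..1}" using v01 by (auto simp: e_def)
    have "h (v - e) \<noteq> h u" using v(3)[OF e(2)] e(1) by auto
    then have "h v < h (v - e)" using u(2)[OF e(2)] v(2) by simp
    moreover have "h v \<le> h (v + e)" using u(2)[OF e(3)] v(2) by simp
    ultimately show False using hmid[OF e(2,3)] by simp
  qed
  then show "(1 - t) * g x + t * g y \<le> g ((1 - t) *\<^sub>R x + t *\<^sub>R y)"
    by (simp add: h_def seg_def)
qed

lemma concave_supergradient:
  fixes g :: "real \<Rightarrow> real"
  assumes "concave_on I g" "c \<in> interior I"
  obtains r where "\<And>x. x \<in> I \<Longrightarrow> g x \<le> g c + r * (x - c)"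
proof -
  define R where "R = Inf ((\<lambda>t. (- g c + g t) / (c - t)) ` ({c<..} \<inter> I))"
  have "g x \<le> g c + (- R) * (x - c)" if "x \<in> I" for x
    using convex_le_Inf_differential[of I "\<lambda>x. - g x" c x] assms that
    unfolding concave_on_def R_def by simp
  then show thesis by (rule that)
qed

text \<open>Young's inequality is the tangent bound for \<open>t powr p\<close> at the mean value; averaging the tangent
  bounds at \<open>a\<close> and \<open>b\<close> gives concavity up to and including the point 0.\<close>

lemma powr_concave_two_point:
  fixes a b t p :: real
  assumes "0 \<le> a" "0 \<le> b" "0 \<le> t" "t \<le> 1" "0 < p" "p \<le> 1"
  shows "(1 - t) * a powr p + t * b powr p \<le> ((1 - t) * a + t * b) powr p"
proof -
  define m where "m = (1 - t) * a + t * b"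
  have m0: "0 \<le> m" unfolding m_def using assms by auto
  show ?thesis
  proof (cases "m = 0")
    case True
    then have "(1 - t) * a = 0" "t * b = 0" unfolding m_def using assms
      by (smt (verit) mult_nonneg_nonneg)+
    then show ?thesis using assms by auto
  next
    case False
    with m0 have m: "0 < m" by simp
    have tan: "x powr p \<le> m powr p * (p * (x / m) + (1 - p))" if "0 \<le> x" for x
    proof (cases "x = 0")
      case False
      then have "(x / m) powr p * 1 powr (1 - p) \<le> p * (x / m) + (1 - p) * 1"
        using m that assms by (intro Youngs_inequality_0) auto
      moreover have "x powr p = m powr p * (x / m) powr p"
        using m that by (simp add: powr_divide)
      ultimately show ?thesis by (simp add: mult_left_mono)
    qed (use assms in auto)
    have "(1 - t) * a powr p + t * b powr p
        \<le> (1 - t) * (m powr p * (p * (a / m) + (1 - p))) + t * (m powr p * (p * (b / m) + (1 - p)))"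
      using assms by (intro add_mono mult_left_mono tan) auto
    also have "\<dots> = m powr p * (p * (((1 - t) * a + t * b) / m) + (1 - p))"
      by (simp add: algebra_simps add_divide_distrib diff_divide_distrib)
    also have "\<dots> = m powr p"
      using m by (simp add: m_def[symmetric])
    finally show ?thesis unfolding m_def .
  qed
qed

text \<open>For \<open>r \<le> 0\<close> the point 1 is a convex combination of the affine bound and \<open>u\<close>, and for \<open>r \<ge> 1\<close> the
  point \<open>u\<close> is a convex combination of the affine bound and 1; both cases then follow from concavity of
  \<open>t powr p\<close>.  For slopes strictly between 0 and 1 the conclusion can fail, as the case
  \<open>v = 1 + r * (u - 1)\<close> shows.\<close>

lemma powr_le_of_affine_bound:
  fixes u v r p :: real
  assumes "0 \<le> u" "0 \<le> v" "v \<le> 1 + r * (u - 1)" "r \<le> 0 \<or> 1 \<le> r" "0 < p" "p \<le> 1"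
  shows "v powr p \<le> 1 + r * (u powr p - 1)"
proof -
  define q where "q = 1 + r * (u - 1)"
  have q: "0 \<le> q" "v powr p \<le> q powr p" unfolding q_def using assms by (auto intro!: powr_mono2)
  have "q powr p \<le> 1 + r * (u powr p - 1)"
  proof (cases "r \<le> 0")
    case True
    define s where "s = - r"
    have s: "0 \<le> s" using True s_def by simp
    \<comment> \<open>\<open>1\<close> is the convex combination \<open>(q + s * u) / (1 + s)\<close>\<close>
    have "(1 - s / (1 + s)) * q powr p + s / (1 + s) * u powr p
      \<le> ((1 - s / (1 + s)) * q + s / (1 + s) * u) powr p"
      using assms q s by (intro powr_concave_two_point) auto
    moreover have "1 - s / (1 + s) = 1 / (1 + s)" using s by (simp add: field_simps)
    moreover have "1 / (1 + s) * q + s / (1 + s) * u = (q + s * u) / (1 + s)"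
      by (simp add: add_divide_distrib)
    moreover have "q + s * u = 1 + s" by (simp add: q_def s_def algebra_simps)
    ultimately have "(q powr p + s * u powr p) / (1 + s) \<le> 1"
      using s by (simp add: add_divide_distrib)
    then show ?thesis using s unfolding s_def by (simp add: field_simps)
  next
    case False
    then have r: "1 \<le> r" using assms by auto
    \<comment> \<open>\<open>u\<close> is the convex combination \<open>(1 - 1 / r) * 1 + (1 / r) * q\<close>\<close>
    have "(1 - 1 / r) * 1 powr p + 1 / r * q powr p \<le> ((1 - 1 / r) * 1 + 1 / r * q) powr p"
      using assms q r by (intro powr_concave_two_point) auto
    moreover have "(1 - 1 / r) * 1 + 1 / r * q = u"
      using r unfolding q_def by (simp add: field_simps)
    ultimately have "(1 - 1 / r) + 1 / r * q powr p \<le> u powr p" by simp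
    then have "r * ((1 - 1 / r) + 1 / r * q powr p) \<le> r * u powr p"
      using r by (intro mult_left_mono) auto
    moreover have "r * ((1 - 1 / r) + 1 / r * q powr p) = r - 1 + q powr p"
      using r by (simp add: ring_distribs)
    ultimately show ?thesis by (simp add: algebra_simps)
  qed
  with q show ?thesis by linarith
qed

text \<open>This is Bernoulli's inequality \<open>s powr r \<le> 1 + r * (s - 1)\<close> at \<open>s = u powr p\<close>.  It covers the slopes
  excluded in the preceding lemma.\<close>

lemma powr_le_of_power_bound:
  fixes u v r p :: real
  assumes "0 < u" "0 \<le> v" "v \<le> u powr r" "0 \<le> r" "r \<le> 1" "0 < p"
  shows "v powr p \<le> 1 + r * (u powr p - 1)"
proof -
  have "v powr p \<le> (u powr r) powr p" using assms by (intro powr_mono2) auto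
  also have "\<dots> = (u powr p) powr r * 1 powr (1 - r)" by (simp add: powr_powr mult.commute)
  also have "\<dots> \<le> r * u powr p + (1 - r) * 1"
    using assms by (intro Youngs_inequality_0) auto
  finally show ?thesis by (simp add: algebra_simps)
qed

lemma doubly_concave_onD:
  assumes "doubly_concave_on \<Omega> f"
  shows "x \<in> \<Omega> \<Longrightarrow> 0 \<le> f x" "continuous_on \<Omega> f" "concave_on \<Omega> f"
    "x \<in> \<Omega> \<Longrightarrow> y \<in> \<Omega> \<Longrightarrow> sqrt (f x * f y) \<le> f (sqrt (x * y))"
  using assms unfolding doubly_concave_on_def by auto

text \<open>Geometric concavity is midpoint concavity of \<open>log f\<close> in the variable \<open>log x\<close>.  The set where \<open>f\<close> is
  positive is an interval because \<open>f\<close> is concave and non-negative.\<close>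

lemma doubly_concave_log_log_concave:
  assumes f: "doubly_concave_on \<Omega> f" and \<Omega>: "is_interval \<Omega>"
  shows "concave_on {s. exp s \<in> \<Omega> \<and> 0 < f (exp s)} (\<lambda>s. ln (f (exp s)))"
    (is "concave_on ?D ?\<phi>")
proof (rule midpoint_concave_imp_concave)
  note fD = doubly_concave_onD[OF f]
  have "is_interval ?D"
  proof (unfold is_interval_1, intro ballI allI impI, elim conjE)
    fix a b x assume ab: "a \<in> ?D" "b \<in> ?D" and x: "a \<le> x" "x \<le> b"
    have ex: "exp a \<le> exp x" "exp x \<le> exp b" using x by auto
    have mem: "exp x \<in> \<Omega>" using \<Omega> ab ex unfolding is_interval_1 by blast
    have "0 < f (exp x)"
    proof (cases "a < b")
      case True
      then have ne: "0 < exp b - exp a" by simp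
      define t where "t = (exp x - exp a) / (exp b - exp a)"
      have "t * (exp b - exp a) = exp x - exp a" using ne by (simp add: t_def)
      then have "exp x = (1 - t) * exp a + t * exp b" by (simp add: algebra_simps)
      moreover have "0 \<le> t" "t \<le> 1" using ex ne unfolding t_def by simp_all
      ultimately have t: "0 \<le> t" "t \<le> 1" "exp x = (1 - t) * exp a + t * exp b" by auto
      then have "f (exp x) \<ge> (1 - t) * f (exp a) + t * f (exp b)"
        using concave_onD[OF fD(3) t(1,2), of "exp a" "exp b"] ab by auto
      moreover have "(1 - t) * f (exp a) + t * f (exp b) > 0"
        using ab t by (cases "t = 0") (auto intro!: add_nonneg_pos mult_nonneg_nonneg)
      ultimately show ?thesis by linarith
    next
      case False
      then have "x = a" using x by auto
      then show ?thesis using ab by auto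
    qed
    with mem show "x \<in> ?D" by auto
  qed
  then show "convex ?D" by (simp add: is_interval_convex_1)
  show "continuous_on ?D ?\<phi>"
    by (intro continuous_intros continuous_on_compose2[OF fD(2)]) auto
  fix x y assume xy: "x \<in> ?D" "y \<in> ?D"
  have "sqrt (f (exp x) * f (exp y)) \<le> f (sqrt (exp x * exp y))"
    using xy by (intro fD(4)) auto
  moreover have "sqrt (exp x * exp y) = exp ((x + y) / 2)"
    by (rule real_sqrt_unique) (auto simp: power2_eq_square mult_exp_exp)
  moreover have "0 < sqrt (f (exp x) * f (exp y))" using xy by simp
  ultimately have "ln (sqrt (f (exp x) * f (exp y))) \<le> ?\<phi> ((x + y) / 2)"
    using ln_mono[of "sqrt (f (exp x) * f (exp y))"] by simp
  moreover have "ln (sqrt (f (exp x) * f (exp y))) = (?\<phi> x + ?\<phi> y) / 2"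
    using xy by (simp add: ln_sqrt ln_mult)
  ultimately show "(?\<phi> x + ?\<phi> y) / 2 \<le> ?\<phi> ((x + y) / 2)" by simp
qed

text \<open>Scale so that \<open>c = 1\<close> and \<open>f(c) = 1\<close>, and let \<open>r\<close> and \<open>q\<close> be supergradients at \<open>c\<close> of \<open>f\<close> and of
  \<open>log f\<close> as a function of \<open>log x\<close>.  If \<open>r\<close> is not in \<open>(0, 1)\<close>, concavity of \<open>t powr p\<close> suffices; if
  \<open>q\<close> is in \<open>[0, 1]\<close>, Bernoulli's inequality does.  In the remaining cases the two bounds together show
  that 1 (for \<open>q > 1\<close>) or 0 (for \<open>q < 0\<close>) is itself a supergradient of \<open>f\<close>, which
  leads back to the first case.\<close>

lemma doubly_concave_powr_supergradient:
  assumes f: "doubly_concave_on \<Omega> f" and \<Omega>: "is_interval \<Omega>" "\<Omega> \<subseteq> {0..}"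
    and c: "c \<in> interior \<Omega>" and fc: "0 < f c" and p: "0 < p" "p \<le> 1"
  obtains s where "\<And>x. x \<in> \<Omega> \<Longrightarrow> f x powr p \<le> f c powr p + s * (x powr p - c powr p)"
proof -
  note fD = doubly_concave_onD[OF f]
  from c obtain e where e: "0 < e" "cball c e \<subseteq> \<Omega>" by (auto simp: mem_interior_cball)
  have ab: "c - e \<in> \<Omega>" "c + e \<in> \<Omega>" "c \<in> \<Omega>" using e by (auto simp: dist_real_def)
  then have c0: "0 < c" using \<Omega>(2) e(1) by force
  define F where "F x = f x / f c" for x
  have F0: "0 \<le> F x" if "x \<in> \<Omega>" for x using fD(1)[OF that] fc F_def by simp
  obtain r0 where r0: "\<And>x. x \<in> \<Omega> \<Longrightarrow> f x \<le> f c + r0 * (x - c)"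
    using concave_supergradient[OF fD(3) c] by blast
  define r where "r = r0 * c / f c"
  have lin: "F x \<le> 1 + r * (x / c - 1)" if "x \<in> \<Omega>" for x
  proof -
    have "F x \<le> (f c + r0 * (x - c)) / f c"
      unfolding F_def using r0[OF that] fc by (intro divide_right_mono) auto
    also have "\<dots> = 1 + r * (x / c - 1)"
      using fc c0 by (simp add: r_def add_divide_distrib right_diff_distrib diff_divide_distrib)
    finally show ?thesis .
  qed
  let ?D = "{s. exp s \<in> \<Omega> \<and> 0 < f (exp s)}"
  \<comment> \<open>a neighbourhood of \<open>c\<close> on which \<open>f\<close> is positive makes \<open>log c\<close> an interior point of the log-log domain\<close>
  have half: "f ((c + y) / 2) > 0" if "y \<in> \<Omega>" for y
    using concave_onD[OF fD(3), of "1/2" c y] ab that fD(1)[OF that] fc by (simp add: field_simps)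
  have pos: "0 < (c + (c - e)) / 2" "0 < (c + (c + e)) / 2" using ab \<Omega>(2) c0 e(1) by auto
  have "(c + (c - e)) / 2 \<in> \<Omega>" "(c + (c + e)) / 2 \<in> \<Omega>"
    using e by (auto simp: dist_real_def field_simps intro!: subsetD[OF e(2)])
  then have "ln ((c + (c - e)) / 2) \<in> ?D" "ln ((c + (c + e)) / 2) \<in> ?D"
    using half[OF ab(1)] half[OF ab(2)] by (simp_all only: mem_Collect_eq exp_ln[OF pos(1)] exp_ln[OF pos(2)] simp_thms)
  moreover have "is_interval ?D"
    using doubly_concave_log_log_concave[OF f \<Omega>(1)] concave_on_imp_convex is_interval_convex_1 by blast
  ultimately have "{ln ((c + (c - e)) / 2)<..<ln ((c + (c + e)) / 2)} \<subseteq> ?D"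
    unfolding is_interval_1 by (meson greaterThanLessThan_iff less_imp_le subsetI)
  moreover have "ln c \<in> {ln ((c + (c - e)) / 2)<..<ln ((c + (c + e)) / 2)}"
    using c0 e ab \<Omega>(2) by (auto intro!: ln_less_cancel_iff[THEN iffD2] simp: add_pos_nonneg)
  ultimately have "ln c \<in> interior ?D"
    by (meson interiorI open_greaterThanLessThan)
  then obtain q where q: "\<And>s. s \<in> ?D \<Longrightarrow> ln (f (exp s)) \<le> ln (f (exp (ln c))) + q * (s - ln c)"
    using concave_supergradient[OF doubly_concave_log_log_concave[OF f \<Omega>(1)], of "ln c"] by blast
  have loglin: "F x \<le> (x / c) powr q" if "x \<in> \<Omega>" "0 < x" for x
  proof (cases "f x = 0")
    case False
    then have fx: "0 < f x" using fD(1)[OF that(1)] by simp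
    then have "ln (F x) \<le> q * ln (x / c)"
      using q[of "ln x"] that c0 fc by (simp add: F_def ln_div)
    then have "exp (ln (F x)) \<le> exp (q * ln (x / c))" by (rule exp_le_cancel_iff[THEN iffD2])
    then show ?thesis using fx fc that c0 by (simp add: F_def powr_def)
  qed (simp add: F_def)
  have "\<exists>s. \<forall>x\<in>\<Omega>. F x powr p \<le> 1 + s * ((x / c) powr p - 1)"
  proof -
    have affine: ?thesis if "s \<le> 0 \<or> 1 \<le> s" "\<And>x. x \<in> \<Omega> \<Longrightarrow> F x \<le> 1 + s * (x / c - 1)" for s
      using that p F0 c0 \<Omega>(2) by (intro exI[of _ s] ballI powr_le_of_affine_bound) auto
    show ?thesis
    proof (cases "r \<le> 0 \<or> 1 \<le> r")
      case True
      then show ?thesis using affine lin by blast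
    next
      case False
      then have r: "0 < r" "r < 1" by auto
      \<comment> \<open>otherwise geometric concavity with the partner 0 makes \<open>f 0\<close> the maximum of \<open>f\<close>, against \<open>r > 0\<close>\<close>
      have zero: "F 0 = 0" if "0 \<in> \<Omega>"
      proof (rule ccontr)
        assume "F 0 \<noteq> 0"
        then have "0 < f 0" using fD(1)[OF that] F_def by force
        moreover have "sqrt (f 0 * f c) \<le> f 0" using fD(4)[OF that ab(3)] by simp
        ultimately have "f 0 * f c \<le> f 0 * f 0"
          using sqrt_le_D[of "f 0 * f c" "f 0"] by (simp add: power2_eq_square)
        then have "f c \<le> f 0" using \<open>0 < f 0\<close> by simp
        then have "1 \<le> F 0" using fc F_def by simp
        then show False using lin[OF that] r by simp
      qed
      consider "0 \<le> q" "q \<le> 1" | "1 < q" | "q < 0" by linarith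
      then show ?thesis
      proof cases
        case 1
        have "F x powr p \<le> 1 + q * ((x / c) powr p - 1)" if x: "x \<in> \<Omega>" for x
        proof (cases "x = 0")
          case True
          then show ?thesis using zero x 1 p by simp
        next
          case False
          then have "0 < x" using x \<Omega>(2) by force
          then show ?thesis using F0[OF x] loglin[OF x] 1 p c0
            by (intro powr_le_of_power_bound) auto
        qed
        then show ?thesis by blast
      next
        case 2
        have "F x \<le> 1 + 1 * (x / c - 1)" if x: "x \<in> \<Omega>" for x
        proof -
          have x0: "0 \<le> x" using x \<Omega>(2) by auto
          consider "x = 0" | "0 < x" "x \<le> c" | "c < x" using x0 by linarith
          then show ?thesis
          proof cases
            case 2
            then have "(x / c) powr q \<le> (x / c) powr 1"
              using \<open>1 < q\<close> c0 by (intro powr_mono') auto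
            then show ?thesis using loglin[OF x] 2 c0 by simp
          next
            case 3
            then have "r * (x / c - 1) \<le> 1 * (x / c - 1)"
              using r c0 by (intro mult_right_mono) auto
            then show ?thesis using lin[OF x] by linarith
          qed (use zero x in auto)
        qed
        then show ?thesis using affine[of 1] by blast
      next
        case 3
        have "F x \<le> 1 + 0 * (x / c - 1)" if x: "x \<in> \<Omega>" for x
        proof (cases "x \<le> c")
          case True
          then have "r * (x / c - 1) \<le> 0" using r c0 by (intro mult_nonneg_nonpos) auto
          then show ?thesis using lin[OF x] by simp
        next
          case False
          then have "(x / c) powr q \<le> (x / c) powr 0"
            using \<open>q < 0\<close> c0 by (intro powr_mono) auto
          then show ?thesis using loglin[OF x] False c0 by auto
        qed
        then show ?thesis using affine[of 0] by blast
      qed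
    qed
  qed
  then obtain s where s: "\<And>x. x \<in> \<Omega> \<Longrightarrow> F x powr p \<le> 1 + s * ((x / c) powr p - 1)" by blast
  show thesis
  proof (rule that)
    fix x assume x: "x \<in> \<Omega>"
    then have x0: "0 \<le> x" using \<Omega>(2) by auto
    have "f x powr p = f c powr p * F x powr p"
      using fD(1)[OF x] fc by (simp add: F_def powr_divide)
    also have "\<dots> \<le> f c powr p * (1 + s * ((x / c) powr p - 1))"
      using s[OF x] by (intro mult_left_mono) auto
    also have "\<dots> = f c powr p + (s * f c powr p / c powr p) * (x powr p - c powr p)"
      using x0 c0 by (simp add: powr_divide field_simps)
    finally show "f x powr p \<le> f c powr p + (s * f c powr p / c powr p) * (x powr p - c powr p)" .
  qed
qed

lemma weighted_mean_between:
  fixes x w :: "'a \<Rightarrow> real"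
  assumes fin: "finite I" and w: "\<And>i. i \<in> I \<Longrightarrow> 0 \<le> w i" "sum w I = 1"
  shows "\<exists>i\<in>I. x i \<le> (\<Sum>i\<in>I. w i * x i)" "\<exists>i\<in>I. (\<Sum>i\<in>I. w i * x i) \<le> x i"
proof -
  obtain k where k: "k \<in> I" "0 < w k"
    using w by (metis less_eq_real_def sum.neutral zero_neq_one)
  have *: "\<exists>i\<in>I. y i \<le> (\<Sum>i\<in>I. w i * y i)" for y :: "'a \<Rightarrow> real"
  proof (rule ccontr)
    define c where "c = (\<Sum>i\<in>I. w i * y i)"
    assume "\<not> ?thesis"
    then have "\<And>i. i \<in> I \<Longrightarrow> c < y i" by (auto simp: c_def not_le)
    then have "0 < (\<Sum>i\<in>I. w i * (y i - c))"
      using k w fin by (intro sum_pos2[of _ k]) (auto simp: less_imp_le)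
    then show False
      using w by (simp add: right_diff_distrib sum_subtractf c_def flip: sum_distrib_right)
  qed
  show "\<exists>i\<in>I. x i \<le> (\<Sum>i\<in>I. w i * x i)" by (rule *)
  show "\<exists>i\<in>I. (\<Sum>i\<in>I. w i * x i) \<le> x i"
    using *[of "\<lambda>i. - x i"] by (simp add: sum_negf)
qed

lemma power_mean_between:
  fixes z w :: "'a \<Rightarrow> real"
  assumes "finite I" and w: "\<And>i. i \<in> I \<Longrightarrow> 0 \<le> w i" "sum w I = 1"
    and z: "\<And>i. i \<in> I \<Longrightarrow> 0 \<le> z i" and p: "0 < p"
  defines "c \<equiv> (\<Sum>i\<in>I. w i * z i powr p) powr (1 / p)"
  shows "0 \<le> c" "c powr p = (\<Sum>i\<in>I. w i * z i powr p)"
    "\<exists>i\<in>I. z i \<le> c" "\<exists>i\<in>I. c \<le> z i"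
proof -
  show c0: "0 \<le> c" unfolding c_def by simp
  have S0: "0 \<le> (\<Sum>i\<in>I. w i * z i powr p)" using w by (intro sum_nonneg) auto
  show cp: "c powr p = (\<Sum>i\<in>I. w i * z i powr p)"
    unfolding c_def using S0 p by (simp add: powr_powr)
  have le: "a \<le> b" if "a powr p \<le> b powr p" "0 \<le> b" for a b :: real
    using powr_less_mono2[of p b a] p that by linarith
  note between = weighted_mean_between[where x = "\<lambda>i. z i powr p" and w = w, OF assms(1) w, folded cp]
  show "\<exists>i\<in>I. z i \<le> c" using between(1) le c0 by blast
  show "\<exists>i\<in>I. c \<le> z i" using between(2) le z by blast
qed

text \<open>At an interior mean \<open>c\<close> the supergradient bound is averaged against the weights, which makes its
  linear term vanish.  At an endpoint of \<open>\<Omega>\<close> every point that carries weight equals \<open>c\<close>.\<close>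

lemma doubly_concave_power_mean:
  fixes z w :: "'a \<Rightarrow> real"
  assumes f: "doubly_concave_on \<Omega> f" and \<Omega>: "is_interval \<Omega>" "\<Omega> \<subseteq> {0..}" and p: "0 < p" "p \<le> 1"
    and fin: "finite I" and w: "\<And>i. i \<in> I \<Longrightarrow> 0 \<le> w i" "sum w I = 1"
    and z: "\<And>i. i \<in> I \<Longrightarrow> z i \<in> \<Omega>"
  shows "(\<Sum>i\<in>I. w i * z i powr p) powr (1 / p) \<in> \<Omega>"
    and "(\<Sum>i\<in>I. w i * f (z i) powr p) \<le> f ((\<Sum>i\<in>I. w i * z i powr p) powr (1 / p)) powr p"
proof -
  note fD = doubly_concave_onD[OF f]
  define c where "c = (\<Sum>i\<in>I. w i * z i powr p) powr (1 / p)"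
  have z0: "\<And>i. i \<in> I \<Longrightarrow> 0 \<le> z i" using z \<Omega>(2) by auto
  note pm = power_mean_between[where z = z and w = w, OF fin w z0 p(1), folded c_def]
  obtain i j where ij: "i \<in> I" "j \<in> I" "z i \<le> c" "c \<le> z j" using pm(3,4) by auto
  then have c\<Omega>: "c \<in> \<Omega>" using mem_is_interval_1_I[OF \<Omega>(1) z z] by blast
  then show "(\<Sum>i\<in>I. w i * z i powr p) powr (1 / p) \<in> \<Omega>" by (simp add: c_def)
  have eq: "(\<Sum>i\<in>I. w i * (z i powr p - c powr p)) = 0"
    using w pm(2) by (simp add: right_diff_distrib sum_subtractf flip: sum_distrib_right)
  have const: "(\<Sum>i\<in>I. w i * f (z i) powr p) \<le> f c powr p"
    if zero: "\<And>i. i \<in> I \<Longrightarrow> w i * (z i powr p - c powr p) = 0"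
  proof -
    have *: "w i * f (z i) powr p = w i * f c powr p" if "i \<in> I" for i
    proof (cases "w i = 0")
      case False
      then have "z i powr p = c powr p" using zero[OF that] by simp
      then have "z i = c" using z0[OF that] pm(1) p
        powr_less_mono2[of p "z i" c] powr_less_mono2[of p c "z i"] by linarith
      then show ?thesis by simp
    qed simp
    have "(\<Sum>i\<in>I. w i * f (z i) powr p) = (\<Sum>i\<in>I. w i) * f c powr p"
      unfolding sum_distrib_right by (intro sum.cong * refl)
    then show ?thesis using w by simp
  qed
  have "(\<Sum>i\<in>I. w i * f (z i) powr p) \<le> f c powr p"
  proof (cases "c \<in> interior \<Omega>")
    case True
    show ?thesis
    proof (cases "f c = 0")
      case False
      then have "0 < f c" using fD(1)[OF c\<Omega>] by simp
      from doubly_concave_powr_supergradient[OF f \<Omega> True this p]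
      obtain s where s: "\<And>x. x \<in> \<Omega> \<Longrightarrow> f x powr p \<le> f c powr p + s * (x powr p - c powr p)" by blast
      have "(\<Sum>i\<in>I. w i * f (z i) powr p) \<le> (\<Sum>i\<in>I. w i * (f c powr p + s * (z i powr p - c powr p)))"
        by (intro sum_mono mult_left_mono s z w)
      also have "\<dots> = f c powr p * sum w I + s * (\<Sum>i\<in>I. w i * (z i powr p - c powr p))"
        by (simp add: sum_distrib_left sum_distrib_right sum.distrib sum_subtractf algebra_simps)
      finally show ?thesis using eq w by simp
    next
      case True
      obtain r where r: "\<And>x. x \<in> \<Omega> \<Longrightarrow> f x \<le> f c + r * (x - c)"
        using concave_supergradient[OF fD(3) \<open>c \<in> interior \<Omega>\<close>] by blast
      from \<open>c \<in> interior \<Omega>\<close> obtain e where e: "0 < e" "cball c e \<subseteq> \<Omega>" by (auto simp: mem_interior_cball)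
      then have ab: "c - e \<in> \<Omega>" "c + e \<in> \<Omega>" by (auto simp: dist_real_def)
      have "0 \<le> r * (- e)" "0 \<le> r * e"
        using r[OF ab(1)] r[OF ab(2)] fD(1)[OF ab(1)] fD(1)[OF ab(2)] True by auto
      then have "r = 0" using e by (simp add: mult_le_0_iff zero_le_mult_iff)
      then have "f x = 0" if "x \<in> \<Omega>" for x using r[OF that] fD(1)[OF that] True by auto
      then show ?thesis using z p by simp
    qed
  next
    case False
    have "(\<forall>x\<in>\<Omega>. c \<le> x) \<or> (\<forall>x\<in>\<Omega>. x \<le> c)"
    proof (rule ccontr)
      assume "\<not> ?thesis"
      then obtain a b where ab: "a \<in> \<Omega>" "b \<in> \<Omega>" "a < c" "c < b" by (auto simp: not_le)
      then have "{a<..<b} \<subseteq> \<Omega>" using \<Omega>(1) unfolding is_interval_1 by (meson greaterThanLessThan_iff less_imp_le subsetI)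
      then have "c \<in> interior \<Omega>" using ab by (intro interiorI[of "{a<..<b}"]) auto
      with False show False by simp
    qed
    then show ?thesis
    proof
      assume "\<forall>x\<in>\<Omega>. c \<le> x"
      then have "0 \<le> w i * (z i powr p - c powr p)" if "i \<in> I" for i
        using w z[OF that] that pm(1) p by (auto intro!: mult_nonneg_nonneg powr_mono2)
      from sum_nonneg_eq_0_iff[where f = "\<lambda>i. w i * (z i powr p - c powr p)", OF fin this] eq show ?thesis by (intro const) blast
    next
      assume "\<forall>x\<in>\<Omega>. x \<le> c"
      then have "w i * (z i powr p - c powr p) \<le> 0" if "i \<in> I" for i
        using w z[OF that] z0[OF that] that p by (auto intro!: mult_nonneg_nonpos powr_mono2)
      then have nn: "0 \<le> - (w i * (z i powr p - c powr p))" if "i \<in> I" for i using that by simp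
      have "(\<Sum>i\<in>I. - (w i * (z i powr p - c powr p))) = 0" using eq by (simp add: sum_negf)
      with sum_nonneg_eq_0_iff[where f = "\<lambda>i. - (w i * (z i powr p - c powr p))", OF fin nn]
      have "\<forall>i\<in>I. - (w i * (z i powr p - c powr p)) = 0" by blast
      then show ?thesis by (intro const) simp
    qed
  qed
  then show "(\<Sum>i\<in>I. w i * f (z i) powr p) \<le> f ((\<Sum>i\<in>I. w i * z i powr p) powr (1 / p)) powr p"
    by (simp add: c_def)
qed

text \<open>This is Jensen's inequality for the concave function \<open>log f\<close> of \<open>log x\<close>, and the limiting case of the
  power mean inequality as \<open>p\<close> tends to 0.\<close>

lemma doubly_concave_geometric_mean:
  fixes z w :: "'a \<Rightarrow> real"
  assumes f: "doubly_concave_on \<Omega> f" and \<Omega>: "is_interval \<Omega>"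
    and fin: "finite I" and w: "\<And>i. i \<in> I \<Longrightarrow> 0 \<le> w i" "sum w I = 1"
    and z: "\<And>i. i \<in> I \<Longrightarrow> z i \<in> \<Omega>" "\<And>i. i \<in> I \<Longrightarrow> 0 < z i" "\<And>i. i \<in> I \<Longrightarrow> 0 < f (z i)"
  shows "exp (\<Sum>i\<in>I. w i * ln (z i)) \<in> \<Omega>"
    and "exp (\<Sum>i\<in>I. w i * ln (f (z i))) \<le> f (exp (\<Sum>i\<in>I. w i * ln (z i)))"
proof -
  let ?D = "{s. exp s \<in> \<Omega> \<and> 0 < f (exp s)}"
  note conc = doubly_concave_log_log_concave[OF f \<Omega>]
  have ne: "I \<noteq> {}" using w by auto
  have lnD: "ln (z i) \<in> ?D" if "i \<in> I" for i using z that by auto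
  have D: "(\<Sum>i\<in>I. w i * ln (z i)) \<in> ?D"
    using convex_sum[OF fin concave_on_imp_convex[OF conc] w(2) w(1) lnD] by (simp only: real_scaleR_def)
  then show "exp (\<Sum>i\<in>I. w i * ln (z i)) \<in> \<Omega>" by blast
  have "(\<Sum>i\<in>I. w i * ln (f (exp (ln (z i))))) \<le> ln (f (exp (\<Sum>i\<in>I. w i * ln (z i))))"
    using concave_on_sum[OF fin ne conc w(2) w(1) lnD] by (simp only: real_scaleR_def)
  then have "(\<Sum>i\<in>I. w i * ln (f (z i))) \<le> ln (f (exp (\<Sum>i\<in>I. w i * ln (z i))))"
    using z by (simp cong: sum.cong)
  then show "exp (\<Sum>i\<in>I. w i * ln (f (z i))) \<le> f (exp (\<Sum>i\<in>I. w i * ln (z i)))"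
    using D by (metis (no_types, lifting) exp_le_cancel_iff exp_ln mem_Collect_eq)
qed

text \<open>The missing weight is placed at the point 0.  This leaves the power mean of the \<open>z\<^sub>i\<close> unchanged and
  adds the non-negative term \<open>(1 - \<Sum> w\<^sub>i) f(0) powr p\<close> to the other sum.\<close>

lemma sub_unital_power_mean_jensen:
  assumes f: "doubly_concave_on \<Omega> f" and \<Omega>: "is_interval \<Omega>" "\<Omega> \<subseteq> {0..}" and p: "0 < p" "p \<le> 1"
    and fin: "finite I" and w: "\<And>i. i \<in> I \<Longrightarrow> 0 \<le> w i" "sum w I \<le> 1"
    and z: "\<And>i. i \<in> I \<Longrightarrow> z i \<in> \<Omega>" and sub: "sum w I = 1 \<or> 0 \<in> \<Omega>"
  shows "(\<Sum>i\<in>I. w i * z i powr p) powr (1 / p) \<in> \<Omega>"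
    and "(\<Sum>i\<in>I. w i * f (z i) powr p) powr (1 / p) \<le> f ((\<Sum>i\<in>I. w i * z i powr p) powr (1 / p))"
proof -
  let ?c = "(\<Sum>i\<in>I. w i * z i powr p) powr (1 / p)"
  have "?c \<in> \<Omega> \<and> (\<Sum>i\<in>I. w i * f (z i) powr p) \<le> f ?c powr p"
  proof (cases "sum w I = 1")
    case True
    then show ?thesis using doubly_concave_power_mean[where z = z and w = w, OF f \<Omega> p fin w(1) True z] by blast
  next
    case False
    then have 0: "0 \<in> \<Omega>" using sub by simp
    \<comment> \<open>\<open>None\<close> indexes the additional point 0\<close>
    define J where "J = insert None (Some ` I)"
    define w' where "w' o' = (case o' of None \<Rightarrow> 1 - sum w I | Some i \<Rightarrow> w i)" for o'
    define z' where "z' o' = (case o' of None \<Rightarrow> 0 | Some i \<Rightarrow> z i)" for o'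
    have sumJ: "(\<Sum>o'\<in>J. w' o' * g (z' o')) = (1 - sum w I) * g 0 + (\<Sum>i\<in>I. w i * g (z i))" for g
      unfolding J_def using fin by (simp add: sum.reindex w'_def z'_def)
    have "finite J" using fin by (simp add: J_def)
    moreover have "0 \<le> w' o'" if "o' \<in> J" for o' using that w by (auto simp: J_def w'_def)
    moreover have "sum w' J = 1" using sumJ[of "\<lambda>_. 1"] by simp
    moreover have "z' o' \<in> \<Omega>" if "o' \<in> J" for o' using that z 0 by (auto simp: J_def z'_def)
    ultimately have "(\<Sum>o'\<in>J. w' o' * z' o' powr p) powr (1 / p) \<in> \<Omega>"
      "(\<Sum>o'\<in>J. w' o' * f (z' o') powr p) \<le> f ((\<Sum>o'\<in>J. w' o' * z' o' powr p) powr (1 / p)) powr p"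
      using doubly_concave_power_mean[OF f \<Omega> p, of J w' z'] by blast+
    moreover have "0 \<le> (1 - sum w I) * f 0 powr p" using w(2) by simp
    ultimately show ?thesis
      unfolding sumJ[of "\<lambda>t. t powr p"] sumJ[of "\<lambda>t. f t powr p"] using p by simp
  qed
  then show c: "?c \<in> \<Omega>" and le: "(\<Sum>i\<in>I. w i * f (z i) powr p) powr (1 / p) \<le> f ?c"
  proof (safe)
    assume c: "?c \<in> \<Omega>" and le: "(\<Sum>i\<in>I. w i * f (z i) powr p) \<le> f ?c powr p"
    have "(\<Sum>i\<in>I. w i * f (z i) powr p) powr (1 / p) \<le> (f ?c powr p) powr (1 / p)"
      using le p w(1) by (intro powr_mono2 sum_nonneg) auto
    also have "\<dots> = f ?c" using doubly_concave_onD(1)[OF f c] p by (simp add: powr_powr)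
    finally show "(\<Sum>i\<in>I. w i * f (z i) powr p) powr (1 / p) \<le> f ?c" .
  qed
qed

section \<open>Adjoints and unitary matrices\<close>

lemma mat_adjoint_carrier [simp, intro]:
  "A \<in> carrier_mat n m \<Longrightarrow> mat_adjoint A \<in> carrier_mat m n"
  by (rule carrier_matI) (simp_all add: mat_adjoint_def)

lemma mat_adjoint_dim [simp]:
  "dim_row (mat_adjoint A) = dim_col A" "dim_col (mat_adjoint A) = dim_row A"
  unfolding mat_adjoint_def by auto

lemma mat_adjoint_index [simp]:
  fixes A :: "complex mat"
  assumes "i < dim_col A" "j < dim_row A"
  shows "mat_adjoint A $$ (i, j) = cnj (A $$ (j, i))"
  using assms unfolding mat_adjoint_def by (simp add: mat_of_rows_index)

lemma mat_mult_index:
  assumes "A \<in> carrier_mat n k" "B \<in> carrier_mat k m" "i < n" "j < m"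
  shows "(A * B) $$ (i, j) = (\<Sum>l<k. A $$ (i, l) * B $$ (l, j))"
  using assms by (simp add: scalar_prod_def atLeast0LessThan)

lemma mat_adjoint_adjoint [simp]: "mat_adjoint (mat_adjoint A) = (A :: complex mat)"
  by (rule eq_matI) auto

lemma mat_adjoint_mult:
  fixes A B :: "complex mat"
  assumes "A \<in> carrier_mat n k" "B \<in> carrier_mat k m"
  shows "mat_adjoint (A * B) = mat_adjoint B * mat_adjoint A"
proof (rule eq_matI)
  fix i j assume "i < dim_row (mat_adjoint B * mat_adjoint A)" "j < dim_col (mat_adjoint B * mat_adjoint A)"
  then have ij: "i < m" "j < n" using assms by auto
  have "(mat_adjoint B * mat_adjoint A) $$ (i, j) = (\<Sum>l<k. mat_adjoint B $$ (i, l) * mat_adjoint A $$ (l, j))"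
    using assms ij by (intro mat_mult_index[where n=m and m=n]) auto
  then show "mat_adjoint (A * B) $$ (i, j) = (mat_adjoint B * mat_adjoint A) $$ (i, j)"
    using assms ij by (simp add: scalar_prod_def atLeast0LessThan mult.commute)
qed (use assms in auto)

lemma unitary_matD:
  assumes "unitary_mat m U"
  shows "U \<in> carrier_mat m m" "U * mat_adjoint U = 1\<^sub>m m" "mat_adjoint U * U = 1\<^sub>m m"
  using assms unfolding unitary_mat_def by auto

lemma unitary_columns:
  assumes "unitary_mat m U" "i < m" "j < m"
  shows "(\<Sum>l<m. cnj (U $$ (l, i)) * U $$ (l, j)) = (if i = j then 1 else 0)"
proof -
  note U = unitary_matD[OF assms(1)]
  have "(mat_adjoint U * U) $$ (i, j) = (\<Sum>l<m. mat_adjoint U $$ (i, l) * U $$ (l, j))"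
    using U assms by (intro mat_mult_index) auto
  then show ?thesis using U assms by simp
qed

lemma unitary_matI:
  assumes U: "U \<in> carrier_mat m m"
    and orth: "\<And>i j. i < m \<Longrightarrow> j < m \<Longrightarrow>
      (\<Sum>l<m. cnj (U $$ (l, i)) * U $$ (l, j)) = (if i = j then 1 else 0)"
  shows "unitary_mat m U"
proof -
  have "mat_adjoint U * U = 1\<^sub>m m"
  proof (rule eq_matI)
    fix i j assume ij: "i < dim_row (1\<^sub>m m :: complex mat)" "j < dim_col (1\<^sub>m m :: complex mat)"
    have "(mat_adjoint U * U) $$ (i, j) = (\<Sum>l<m. mat_adjoint U $$ (i, l) * U $$ (l, j))"
      using U ij by (intro mat_mult_index) auto
    then show "(mat_adjoint U * U) $$ (i, j) = 1\<^sub>m m $$ (i, j)"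
      using U ij orth[of i j] by simp
  qed (use U in auto)
  then show ?thesis
    using mat_mult_left_right_inverse[of "mat_adjoint U" m U] U unfolding unitary_mat_def by auto
qed

lemma unitary_mat_adjoint: "unitary_mat m U \<Longrightarrow> unitary_mat m (mat_adjoint U)"
  unfolding unitary_mat_def by auto

lemma mult_assoc_square:
  fixes A B C :: "complex mat"
  assumes "A \<in> carrier_mat m m" "B \<in> carrier_mat m m" "C \<in> carrier_mat m m"
  shows "(A * B) * C = A * (B * C)"
  using assms by (rule assoc_mult_mat)

lemma mult_closed_square:
  fixes A B :: "complex mat"
  assumes "A \<in> carrier_mat m m" "B \<in> carrier_mat m m"
  shows "A * B \<in> carrier_mat m m"
  using assms by (rule mult_carrier_mat)

lemma unitary_cancel:
  assumes U: "unitary_mat m U" and X: "X \<in> carrier_mat m m"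
  shows "U * (mat_adjoint U * X) = X" "mat_adjoint U * (U * X) = X"
  using unitary_matD[OF U] X mult_assoc_square[of U m "mat_adjoint U" X]
    mult_assoc_square[of "mat_adjoint U" m U X] by auto

lemma unitary_mat_mult:
  assumes U: "unitary_mat m U" and V: "unitary_mat m V"
  shows "unitary_mat m (U * V)"
proof -
  note U' = unitary_matD[OF U] and V' = unitary_matD[OF V]
  have adj: "mat_adjoint (U * V) = mat_adjoint V * mat_adjoint U"
    using U' V' by (intro mat_adjoint_mult) auto
  show ?thesis
    unfolding unitary_mat_def adj using U' V'
    by (simp add: mult_assoc_square[of _ m] mult_closed_square[of _ m] unitary_cancel[OF U] unitary_cancel[OF V])
qed

text \<open>Only real diagonals occur, so every matrix of this form with unitary \<open>U\<close> is Hermitian.\<close>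

definition udiag :: "nat \<Rightarrow> complex mat \<Rightarrow> (nat \<Rightarrow> real) \<Rightarrow> complex mat" where
  "udiag m U d = U * mat_diag m (\<lambda>i. complex_of_real (d i)) * mat_adjoint U"

lemma udiag_carrier [simp]: "U \<in> carrier_mat m m \<Longrightarrow> udiag m U d \<in> carrier_mat m m"
  unfolding udiag_def by (simp add: mult_closed_square)

lemma udiag_dim [simp]:
  "U \<in> carrier_mat m m \<Longrightarrow> dim_row (udiag m U d) = m"
  "U \<in> carrier_mat m m \<Longrightarrow> dim_col (udiag m U d) = m"
  by (rule carrier_matD[OF udiag_carrier], assumption)+

lemma udiag_index:
  assumes "U \<in> carrier_mat m m" "i < m" "j < m"
  shows "udiag m U d $$ (i, j) = (\<Sum>l<m. complex_of_real (d l) * (U $$ (i, l) * cnj (U $$ (j, l))))"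
proof -
  have "udiag m U d $$ (i, j) =
      (\<Sum>l<m. (U * mat_diag m (\<lambda>i. complex_of_real (d i))) $$ (i, l) * mat_adjoint U $$ (l, j))"
    unfolding udiag_def using assms by (intro mat_mult_index[of _ m]) (simp_all add: mult_closed_square)
  then show ?thesis using assms by (simp add: mat_diag_mult_right[of _ m m] mult_ac)
qed

lemma udiag_cong:
  assumes "\<And>i. i < m \<Longrightarrow> d i = e i"
  shows "udiag m U d = udiag m U e"
proof -
  have "mat_diag m (\<lambda>i. complex_of_real (d i)) = mat_diag m (\<lambda>i. complex_of_real (e i))"
    by (rule eq_matI) (auto simp: mat_diag_def assms)
  then show ?thesis unfolding udiag_def by simp
qed

lemma udiag_const_one:
  assumes "unitary_mat m U" shows "udiag m U (\<lambda>_. 1) = 1\<^sub>m m"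
  using unitary_matD[OF assms] unfolding udiag_def by (simp add: right_mult_one_mat[of _ m m])

lemma udiag_adjoint:
  assumes "U \<in> carrier_mat m m"
  shows "mat_adjoint (udiag m U d) = udiag m U d"
  by (rule eq_matI) (use assms in \<open>auto simp: udiag_index mult_ac\<close>)

lemma udiag_add:
  assumes "U \<in> carrier_mat m m"
  shows "udiag m U a + udiag m U b = udiag m U (\<lambda>i. a i + b i)"
  by (rule eq_matI) (use assms in \<open>auto simp: udiag_index sum.distrib ring_distribs\<close>)

lemma udiag_minus:
  assumes "U \<in> carrier_mat m m"
  shows "udiag m U a - udiag m U b = udiag m U (\<lambda>i. a i - b i)"
  by (rule eq_matI) (use assms in \<open>auto simp: udiag_index sum_subtractf ring_distribs\<close>)

lemma udiag_smult:
  assumes "U \<in> carrier_mat m m"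
  shows "complex_of_real c \<cdot>\<^sub>m udiag m U a = udiag m U (\<lambda>i. c * a i)"
  by (rule eq_matI) (use assms in \<open>auto simp: udiag_index sum_distrib_left mult_ac\<close>)

lemma udiag_conjugate:
  assumes "W \<in> carrier_mat m m" "U \<in> carrier_mat m m"
  shows "W * udiag m U d * mat_adjoint W = udiag m (W * U) d"
proof -
  have D: "mat_diag m (\<lambda>i. complex_of_real (d i)) \<in> carrier_mat m m" by simp
  have adj: "mat_adjoint (W * U) = mat_adjoint U * mat_adjoint W"
    using assms by (intro mat_adjoint_mult) auto
  show ?thesis unfolding udiag_def adj using assms D
    by (simp add: mult_assoc_square[of _ m] mult_closed_square[of _ m])
qed

section \<open>Coordinates and quadratic forms\<close>

text \<open>For unitary \<open>U\<close> these are the coordinates of \<open>x\<close> in the basis of its columns.  Vectors are functions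
  on the natural numbers of which only the values below \<open>m\<close> matter.\<close>

definition coord :: "nat \<Rightarrow> complex mat \<Rightarrow> (nat \<Rightarrow> complex) \<Rightarrow> nat \<Rightarrow> complex" where
  "coord m U x l = (\<Sum>i<m. cnj (U $$ (i, l)) * x i)"

definition qform :: "nat \<Rightarrow> complex mat \<Rightarrow> (nat \<Rightarrow> complex) \<Rightarrow> complex" where
  "qform m A x = (\<Sum>i<m. \<Sum>j<m. cnj (x i) * A $$ (i, j) * x j)"

lemma qform_udiag:
  assumes "U \<in> carrier_mat m m"
  shows "qform m (udiag m U d) x = complex_of_real (\<Sum>l<m. d l * (cmod (coord m U x l))\<^sup>2)"
proof -
  have "qform m (udiag m U d) x =
      (\<Sum>i<m. \<Sum>j<m. \<Sum>l<m. complex_of_real (d l) * (cnj (x i) * U $$ (i, l)) * (cnj (U $$ (j, l)) * x j))"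
    unfolding qform_def using assms
    by (intro sum.cong refl) (simp add: udiag_index sum_distrib_left sum_distrib_right mult_ac)
  also have "\<dots> = (\<Sum>i<m. \<Sum>l<m. \<Sum>j<m. complex_of_real (d l) * (cnj (x i) * U $$ (i, l)) * (cnj (U $$ (j, l)) * x j))"
    by (intro sum.cong refl sum.swap)
  also have "\<dots> = (\<Sum>l<m. \<Sum>i<m. \<Sum>j<m. complex_of_real (d l) * (cnj (x i) * U $$ (i, l)) * (cnj (U $$ (j, l)) * x j))"
    by (rule sum.swap)
  also have "\<dots> = (\<Sum>l<m. complex_of_real (d l) * (cnj (coord m U x l) * coord m U x l))"
    unfolding coord_def cnj_sum by (simp add: sum_product sum_distrib_left mult_ac)
  also have "\<dots> = (\<Sum>l<m. complex_of_real (d l * (cmod (coord m U x l))\<^sup>2))"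
    by (simp only: complex_norm_square of_real_mult mult_ac)
  finally show ?thesis by simp
qed

lemma qform_one: "qform m (1\<^sub>m m) x = complex_of_real (\<Sum>i<m. (cmod (x i))\<^sup>2)"
proof -
  have "qform m (1\<^sub>m m) x = (\<Sum>i<m. \<Sum>j<m. if i = j then cnj (x i) * x j else 0)"
    unfolding qform_def by (intro sum.cong refl) auto
  also have "\<dots> = (\<Sum>i<m. complex_of_real ((cmod (x i))\<^sup>2))"
    by (simp add: sum.delta complex_norm_square mult.commute del: of_real_power)
  finally show ?thesis by simp
qed

lemma coord_parseval:
  assumes "unitary_mat m U"
  shows "(\<Sum>l<m. (cmod (coord m U x l))\<^sup>2) = (\<Sum>i<m. (cmod (x i))\<^sup>2)"
proof -
  have "complex_of_real (\<Sum>l<m. 1 * (cmod (coord m U x l))\<^sup>2) = complex_of_real (\<Sum>i<m. (cmod (x i))\<^sup>2)"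
    using qform_udiag[OF unitary_matD(1)[OF assms], of "\<lambda>_. 1" x] qform_one[of m x]
    by (simp only: udiag_const_one[OF assms])
  then show ?thesis by (simp only: of_real_eq_iff mult_1)
qed

definition overlap :: "nat \<Rightarrow> complex mat \<Rightarrow> complex mat \<Rightarrow> nat \<Rightarrow> nat \<Rightarrow> complex" where
  "overlap m U V l k = coord m U (\<lambda>i. V $$ (i, k)) l"

lemma overlap_same:
  assumes "unitary_mat m U" "l < m" "k < m"
  shows "overlap m U U l k = (if l = k then 1 else 0)"
  unfolding overlap_def coord_def by (rule unitary_columns[OF assms])

lemma cmod_overlap_swap: "cmod (overlap m U V l k) = cmod (overlap m V U k l)"
proof -
  have "overlap m U V l k = cnj (overlap m V U k l)"
    unfolding overlap_def coord_def by (simp add: mult.commute)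
  then show ?thesis by simp
qed

lemma unitary_column_norm:
  assumes "unitary_mat m U" "k < m" shows "(\<Sum>i<m. (cmod (U $$ (i, k)))\<^sup>2) = 1"
proof -
  have "complex_of_real (\<Sum>i<m. (cmod (U $$ (i, k)))\<^sup>2) = (\<Sum>l<m. cnj (U $$ (l, k)) * U $$ (l, k))"
    by (simp add: complex_norm_square mult.commute del: of_real_power)
  then show ?thesis using unitary_columns[OF assms(1,2,2)] 
    by (metis of_real_eq_1_iff)
qed

lemma overlap_sums:
  assumes "unitary_mat m U" "unitary_mat m V" "k < m"
  shows "(\<Sum>l<m. (cmod (overlap m U V l k))\<^sup>2) = 1" "(\<Sum>l<m. (cmod (overlap m U V k l))\<^sup>2) = 1"
proof -
  have *: "(\<Sum>l<m. (cmod (overlap m U V l k))\<^sup>2) = 1" if "unitary_mat m U" "unitary_mat m V" for U V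
    unfolding overlap_def coord_parseval[OF that(1)] by (rule unitary_column_norm[OF that(2) assms(3)])
  show "(\<Sum>l<m. (cmod (overlap m U V l k))\<^sup>2) = 1" by (rule *[OF assms(1,2)])
  show "(\<Sum>l<m. (cmod (overlap m U V k l))\<^sup>2) = 1"
    unfolding cmod_overlap_swap[of m U V k] by (rule *[OF assms(2,1)])
qed

section \<open>The Frobenius norm and functional calculus\<close>

definition frobenius_sq :: "nat \<Rightarrow> complex mat \<Rightarrow> real" where
  "frobenius_sq m A = (\<Sum>i<m. \<Sum>j<m. (cmod (A $$ (i, j)))\<^sup>2)"

text \<open>Parseval's identity applied first to the rows and then to the columns.\<close>

lemma frobenius_sq_unitary:
  assumes U: "unitary_mat m U" and V: "unitary_mat m V"
  shows "frobenius_sq m A =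
    (\<Sum>l<m. \<Sum>k<m. (cmod (\<Sum>i<m. \<Sum>j<m. cnj (U $$ (i, l)) * A $$ (i, j) * V $$ (j, k)))\<^sup>2)"
proof -
  have "frobenius_sq m A = (\<Sum>i<m. \<Sum>k<m. (cmod (coord m V (\<lambda>j. cnj (A $$ (i, j))) k))\<^sup>2)"
    unfolding frobenius_sq_def coord_parseval[OF V] by simp
  also have "\<dots> = (\<Sum>k<m. \<Sum>i<m. (cmod (\<Sum>j<m. A $$ (i, j) * V $$ (j, k)))\<^sup>2)"
  proof (subst sum.swap, intro sum.cong refl)
    fix i k
    have "coord m V (\<lambda>j. cnj (A $$ (i, j))) k = cnj (\<Sum>j<m. A $$ (i, j) * V $$ (j, k))"
      unfolding coord_def by (simp add: mult.commute)
    then show "(cmod (coord m V (\<lambda>j. cnj (A $$ (i, j))) k))\<^sup>2 = (cmod (\<Sum>j<m. A $$ (i, j) * V $$ (j, k)))\<^sup>2"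
      by (simp only: complex_mod_cnj)
  qed
  also have "\<dots> = (\<Sum>k<m. \<Sum>l<m. (cmod (coord m U (\<lambda>i. \<Sum>j<m. A $$ (i, j) * V $$ (j, k)) l))\<^sup>2)"
    unfolding coord_parseval[OF U] by simp
  also have "\<dots> = (\<Sum>l<m. \<Sum>k<m. (cmod (\<Sum>i<m. \<Sum>j<m. cnj (U $$ (i, l)) * A $$ (i, j) * V $$ (j, k)))\<^sup>2)"
    by (subst sum.swap) (simp add: coord_def sum_distrib_left mult.assoc)
  finally show ?thesis .
qed

lemma udiag_apply_column:
  assumes U: "unitary_mat m U" and ik: "i < m" "k < m"
  shows "(\<Sum>j<m. udiag m U d $$ (i, j) * U $$ (j, k)) = complex_of_real (d k) * U $$ (i, k)"
proof -
  have "(\<Sum>j<m. udiag m U d $$ (i, j) * U $$ (j, k))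
      = (\<Sum>j<m. \<Sum>l<m. complex_of_real (d l) * U $$ (i, l) * (cnj (U $$ (j, l)) * U $$ (j, k)))"
    using unitary_matD(1)[OF U] ik
    by (intro sum.cong refl) (simp add: udiag_index sum_distrib_left mult_ac)
  also have "\<dots> = (\<Sum>l<m. complex_of_real (d l) * U $$ (i, l) * (\<Sum>j<m. cnj (U $$ (j, l)) * U $$ (j, k)))"
    by (subst sum.swap) (simp add: sum_distrib_left)
  also have "\<dots> = (\<Sum>l<m. if l = k then complex_of_real (d l) * U $$ (i, l) else 0)"
    using ik by (intro sum.cong refl) (simp add: unitary_columns[OF U])
  also have "\<dots> = complex_of_real (d k) * U $$ (i, k)" using ik by (simp add: sum.delta)
  finally show ?thesis .
qed

text \<open>In the mixed basis formed by the columns of \<open>U\<close> on the left and of \<open>V\<close> on the right, the difference of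
  the two matrices has the entries \<open>(a\<^sub>l - b\<^sub>k) \<langle>u\<^sub>l, v\<^sub>k\<rangle>\<close>.  Applying a function to both matrices changes
  only the first factor, so this identity controls the whole functional calculus: it yields both
  its independence of the diagonalisation and its Lipschitz continuity.\<close>

lemma frobenius_sq_udiag_diff:
  assumes U: "unitary_mat m U" and V: "unitary_mat m V"
  shows "frobenius_sq m (udiag m U a - udiag m V b)
    = (\<Sum>l<m. \<Sum>k<m. (a l - b k)\<^sup>2 * (cmod (overlap m U V l k))\<^sup>2)"
proof -
  note cU = unitary_matD(1)[OF U] and cV = unitary_matD(1)[OF V]
  have "(\<Sum>i<m. \<Sum>j<m. cnj (U $$ (i, l)) * (udiag m U a - udiag m V b) $$ (i, j) * V $$ (j, k))
      = complex_of_real (a l - b k) * overlap m U V l k" if lk: "l < m" "k < m" for l k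
  proof -
    have 1: "(\<Sum>i<m. \<Sum>j<m. cnj (U $$ (i, l)) * udiag m V b $$ (i, j) * V $$ (j, k))
        = complex_of_real (b k) * overlap m U V l k"
    proof -
      have "(\<Sum>i<m. \<Sum>j<m. cnj (U $$ (i, l)) * udiag m V b $$ (i, j) * V $$ (j, k))
         = (\<Sum>i<m. cnj (U $$ (i, l)) * (\<Sum>j<m. udiag m V b $$ (i, j) * V $$ (j, k)))"
        by (simp add: sum_distrib_left mult.assoc)
      also have "\<dots> = (\<Sum>i<m. cnj (U $$ (i, l)) * (complex_of_real (b k) * V $$ (i, k)))"
        using lk by (intro sum.cong refl) (simp add: udiag_apply_column[OF V])
      finally show ?thesis unfolding overlap_def coord_def by (simp add: sum_distrib_left mult_ac)
    qed
    have 2: "(\<Sum>i<m. \<Sum>j<m. cnj (U $$ (i, l)) * udiag m U a $$ (i, j) * V $$ (j, k))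
        = complex_of_real (a l) * overlap m U V l k"
    proof -
      have herm: "udiag m U a $$ (i, j) = cnj (udiag m U a $$ (j, i))" if "i < m" "j < m" for i j
        using that cU by (simp add: udiag_index mult_ac)
      have "(\<Sum>i<m. \<Sum>j<m. cnj (U $$ (i, l)) * udiag m U a $$ (i, j) * V $$ (j, k))
         = (\<Sum>j<m. \<Sum>i<m. cnj (udiag m U a $$ (j, i) * U $$ (i, l)) * V $$ (j, k))"
        by (subst sum.swap, intro sum.cong refl, subst herm) (auto simp: mult_ac)
      also have "\<dots> = (\<Sum>j<m. cnj (\<Sum>i<m. udiag m U a $$ (j, i) * U $$ (i, l)) * V $$ (j, k))"
        by (simp add: sum_distrib_right)
      also have "\<dots> = (\<Sum>j<m. cnj (complex_of_real (a l) * U $$ (j, l)) * V $$ (j, k))"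
        using lk by (intro sum.cong refl) (simp add: udiag_apply_column[OF U])
      finally show ?thesis unfolding overlap_def coord_def by (simp add: sum_distrib_left mult_ac)
    qed
    have "(\<Sum>i<m. \<Sum>j<m. cnj (U $$ (i, l)) * (udiag m U a - udiag m V b) $$ (i, j) * V $$ (j, k))
      = (\<Sum>i<m. \<Sum>j<m. cnj (U $$ (i, l)) * udiag m U a $$ (i, j) * V $$ (j, k))
      - (\<Sum>i<m. \<Sum>j<m. cnj (U $$ (i, l)) * udiag m V b $$ (i, j) * V $$ (j, k))"
      using cU cV by (simp add: ring_distribs flip: sum_subtractf)
    then show ?thesis unfolding 1 2 by (simp add: algebra_simps)
  qed
  then show ?thesis unfolding frobenius_sq_unitary[OF U V]
    by (intro sum.cong refl) (simp add: norm_mult power_mult_distrib flip: of_real_diff)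
qed

lemma frobenius_sq_eq_0:
  assumes "A \<in> carrier_mat m m" "B \<in> carrier_mat m m" "frobenius_sq m (A - B) = 0"
  shows "A = B"
proof (rule eq_matI)
  fix i j assume ij: "i < dim_row B" "j < dim_col B"
  have "(\<Sum>j<m. (cmod ((A - B) $$ (i, j)))\<^sup>2) = 0"
    using assms ij unfolding frobenius_sq_def
    by (subst (asm) sum_nonneg_eq_0_iff) (auto intro!: sum_nonneg)
  then have "(cmod ((A - B) $$ (i, j)))\<^sup>2 = 0"
    using assms ij by (subst (asm) sum_nonneg_eq_0_iff) auto
  then show "A $$ (i, j) = B $$ (i, j)" using assms ij by simp
qed (use assms in auto)

text \<open>Where \<open>\<langle>u\<^sub>l, v\<^sub>k\<rangle>\<close> is nonzero the eigenvalues \<open>a\<^sub>l\<close> and \<open>b\<^sub>k\<close> agree, hence so do their images under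
  \<open>f\<close>.\<close>

lemma udiag_functional_calculus_unique:
  assumes U: "unitary_mat m U" and V: "unitary_mat m V" and eq: "udiag m U a = udiag m V b"
  shows "udiag m U (\<lambda>i. f (a i)) = udiag m V (\<lambda>i. f (b i))"
proof (rule frobenius_sq_eq_0)
  show "udiag m U (\<lambda>i. f (a i)) \<in> carrier_mat m m" "udiag m V (\<lambda>i. f (b i)) \<in> carrier_mat m m"
    using unitary_matD(1) U V by auto
  have 0: "(\<Sum>l<m. \<Sum>k<m. (a l - b k)\<^sup>2 * (cmod (overlap m U V l k))\<^sup>2) = 0"
    unfolding frobenius_sq_udiag_diff[OF U V, symmetric] eq
    using unitary_matD(1)[OF V] by (simp add: frobenius_sq_def)
  have "(a l - b k)\<^sup>2 * (cmod (overlap m U V l k))\<^sup>2 = 0" if "l < m" "k < m" for l k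
  proof -
    have "(\<Sum>k<m. (a l - b k)\<^sup>2 * (cmod (overlap m U V l k))\<^sup>2) = 0"
      using 0 that by (subst (asm) sum_nonneg_eq_0_iff) (auto intro!: sum_nonneg)
    then show ?thesis using that by (subst (asm) sum_nonneg_eq_0_iff) auto
  qed
  then have "(f (a l) - f (b k))\<^sup>2 * (cmod (overlap m U V l k))\<^sup>2 = 0" if "l < m" "k < m" for l k
    using that by fastforce
  then show "frobenius_sq m (udiag m U (\<lambda>i. f (a i)) - udiag m V (\<lambda>i. f (b i))) = 0"
    unfolding frobenius_sq_udiag_diff[OF U V] by (simp add: sum.neutral)
qed

lemma mat_fun_udiag:
  assumes U: "unitary_mat m U"
  shows "mat_fun f (udiag m U d) = udiag m U (\<lambda>i. f (d i))"
proof -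
  have dim: "dim_row (udiag m U d) = m" using unitary_matD(1)[OF U] by simp
  show ?thesis
    unfolding mat_fun_def Let_def dim udiag_def[symmetric]
  proof (rule the_equality)
    show "\<exists>V e. unitary_mat m V \<and> udiag m U d = udiag m V e \<and>
        udiag m U (\<lambda>i. f (d i)) = udiag m V (\<lambda>i. f (e i))"
      using U by blast
  next
    fix B assume "\<exists>V e. unitary_mat m V \<and> udiag m U d = udiag m V e \<and> B = udiag m V (\<lambda>i. f (e i))"
    then show "B = udiag m U (\<lambda>i. f (d i))"
      using udiag_functional_calculus_unique[OF U] by metis
  qed
qed

section \<open>Spectrum and eigenvalues of a diagonalised matrix\<close>

lemma char_poly_udiag:
  assumes U: "unitary_mat m U"
  shows "char_poly (udiag m U d) = (\<Prod>a\<leftarrow>map (\<lambda>i. complex_of_real (d i)) [0..<m]. [:- a, 1:])"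
proof -
  let ?D = "mat_diag m (\<lambda>i. complex_of_real (d i))"
  have "similar_mat_wit (udiag m U d) ?D U (mat_adjoint U)"
    using unitary_matD[OF U] by (intro similar_mat_witI[of _ _ m]) (auto simp: udiag_def intro!: mult_carrier_mat[of _ m m])
  then have "char_poly (udiag m U d) = char_poly ?D"
    by (intro char_poly_similar) (auto simp: similar_mat_def)
  also have "\<dots> = (\<Prod>a\<leftarrow>diag_mat ?D. [:- a, 1:])"
    by (rule char_poly_upper_triangular[of _ m]) (auto simp: mat_diag_def)
  also have "diag_mat ?D = map (\<lambda>i. complex_of_real (d i)) [0..<m]"
    by (auto simp: diag_mat_def mat_diag_def)
  finally show ?thesis .
qed

lemma spectrum_udiag:
  assumes U: "unitary_mat m U"
  shows "spectrum (udiag m U d) = complex_of_real ` d ` {..<m}"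
  unfolding spectrum_root_char_poly[OF udiag_carrier[OF unitary_matD(1)[OF U]]] char_poly_udiag[OF U]
  by (auto simp: poly_prod_list prod_list_zero_iff)

lemma udiag_in_hermitian_mats_iff:
  assumes U: "unitary_mat m U"
  shows "udiag m U d \<in> hermitian_mats m \<Omega> \<longleftrightarrow> (\<forall>i<m. d i \<in> \<Omega>)"
  unfolding hermitian_mats_def mem_Collect_eq spectrum_udiag[OF U]
  using udiag_carrier[OF unitary_matD(1)[OF U]] udiag_adjoint[OF unitary_matD(1)[OF U]]
  by (auto simp: subset_iff image_iff)

lemma proots_linear_factors:
  "proots (\<Prod>a\<leftarrow>xs. [:- a, 1:]) = (mset xs :: complex multiset)"
proof (induction xs)
  case (Cons a xs)
  have "(\<Prod>a\<leftarrow>xs. [:- a, 1:]) \<noteq> (0 :: complex poly)" by (auto simp: prod_list_zero_iff)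
  then have "proots ([:- a, 1:] * (\<Prod>a\<leftarrow>xs. [:- a, 1:])) = {#a#} + mset xs"
    by (subst proots_mult) (auto simp: Cons.IH)
  then show ?case by simp
qed simp

lemma eig_udiag:
  assumes U: "unitary_mat m U" and mono: "\<And>i j. i \<le> j \<Longrightarrow> j < m \<Longrightarrow> d i \<le> d j"
    and j: "1 \<le> j" "j \<le> m"
  shows "eig (udiag m U d) (m + 1 - j) = d (j - 1)"
proof -
  have "image_mset Re (proots (char_poly (udiag m U d))) = mset (map d [0..<m])"
    unfolding char_poly_udiag[OF U] proots_linear_factors by (simp add: multiset.map_comp comp_def)
  then have "eig_desc (udiag m U d) = rev (sort (map d [0..<m]))"
    unfolding eig_desc_def by (simp only: sorted_list_of_multiset_mset)
  also have "sort (map d [0..<m]) = map d [0..<m]"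
    by (rule sorted_sort_id) (auto simp: sorted_iff_nth_mono intro!: mono)
  finally show ?thesis unfolding eig_def using j by (simp add: rev_nth)
qed

section \<open>Spectral theorem for Hermitian matrices\<close>

text \<open>Complete \<open>v\<close> to a basis, orthogonalise it and normalise the columns; Gram-Schmidt keeps the first
  vector.\<close>

lemma unitary_extending_unit_vector:
  fixes v :: "complex vec"
  assumes v: "v \<in> carrier_vec n" "v \<noteq> 0\<^sub>v n"
  obtains W c where "unitary_mat n W" "\<And>i. i < n \<Longrightarrow> W $$ (i, 0) = c * v $ i"
proof -
  interpret cof_vec_space n "TYPE(complex)" .
  from v have n: "n \<noteq> 0" by (metis carrier_vecD eq_vecI index_zero_vec(2) less_nat_zero_code)
  define b where "b = basis_completion v"
  define ws where "ws = gram_schmidt n b"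
  note bc = basis_completion[OF v, folded b_def]
  have b: "set b \<subseteq> carrier_vec n" "distinct b" "\<not> lin_dep (set b)" "hd b = v" "length b = n"
    using bc by auto
  from b n obtain vs where bv: "b = v # vs" by (cases b) auto
  from gram_schmidt_result[OF b(1,2,3) refl, folded ws_def] b(5)
  have ws: "set ws \<subseteq> carrier_vec n" "corthogonal ws" "length ws = n" by auto
  have "hd ws = v" using gram_schmidt_hd[OF v(1), of vs] unfolding ws_def bv .
  then have ws0: "ws ! 0 = v" using ws(3) n by (metis hd_conv_nth list.size(3))
  have wsc: "ws ! k \<in> carrier_vec n" if "k < n" for k using ws that by auto
  define N where "N k = (\<Sum>i<n. (cmod (ws ! k $ i))\<^sup>2)" for k
  have ip: "(\<Sum>i<n. cnj (ws ! k $ i) * ws ! l $ i) = ws ! l \<bullet>c ws ! k" if "k < n" "l < n" for k l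
    using wsc[OF that(1)] wsc[OF that(2)]
    by (simp add: scalar_prod_def atLeast0LessThan mult.commute)
  have NN: "complex_of_real (N k) = ws ! k \<bullet>c ws ! k" if "k < n" for k
    unfolding N_def ip[OF that that, symmetric] by (simp add: complex_norm_square mult.commute del: of_real_power)
  have Npos: "0 < N k" if "k < n" for k
  proof -
    have "ws ! k \<bullet>c ws ! k \<noteq> 0" using corthogonalD[OF ws(2), of k k] ws(3) that by auto
    then have "N k \<noteq> 0" using NN[OF that] by auto
    moreover have "0 \<le> N k" unfolding N_def by (intro sum_nonneg) auto
    ultimately show ?thesis by simp
  qed
  define W where "W = Matrix.mat n n (\<lambda>(i, k). complex_of_real (1 / sqrt (N k)) * ws ! k $ i)"
  have "unitary_mat n W"
  proof (rule unitary_matI)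
    show "W \<in> carrier_mat n n" unfolding W_def by simp
    fix k l assume kl: "k < n" "l < n"
    have "(\<Sum>i<n. cnj (W $$ (i, k)) * W $$ (i, l))
        = complex_of_real (1 / sqrt (N k)) * complex_of_real (1 / sqrt (N l)) * (\<Sum>i<n. cnj (ws ! k $ i) * ws ! l $ i)"
      using kl by (simp add: W_def sum_distrib_left mult_ac)
    also have "\<dots> = (if k = l then 1 else 0)"
    proof (cases "k = l")
      case True
      have "complex_of_real (1 / sqrt (N k)) * complex_of_real (1 / sqrt (N k)) * complex_of_real (N k) = 1"
        using Npos[OF kl(1)] by (simp flip: of_real_mult add: field_simps)
      moreover have "(\<Sum>i<n. cnj (ws ! k $ i) * ws ! l $ i) = complex_of_real (N k)"
        using ip[OF kl(1) kl(1)] NN[OF kl(1)] True by simp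
      ultimately show ?thesis using True by simp
    next
      case False
      then show ?thesis using ip[OF kl] corthogonalD[OF ws(2), of l k] ws(3) kl by auto
    qed
    finally show "(\<Sum>i<n. cnj (W $$ (i, k)) * W $$ (i, l)) = (if k = l then 1 else 0)" .
  qed
  moreover have "W $$ (i, 0) = complex_of_real (1 / sqrt (N 0)) * v $ i" if "i < n" for i
    using that n by (simp add: W_def ws0)
  ultimately show thesis by (rule that)
qed

text \<open>The first column of \<open>W\<close> is a normalised eigenvector of \<open>A\<close>.  The conjugated matrix is again
  Hermitian, which forces its corner entry to be real.\<close>

lemma hermitian_deflation:
  assumes A: "A \<in> carrier_mat (Suc m) (Suc m)" "mat_adjoint A = (A :: complex mat)"
  obtains W e where "unitary_mat (Suc m) W"
    "\<And>i. i < Suc m \<Longrightarrow> (mat_adjoint W * A * W) $$ (i, 0) = (if i = 0 then complex_of_real e else 0)"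
proof -
  let ?n = "Suc m"
  from spectrum_non_empty[OF A(1)] obtain c where "c \<in> spectrum A" by auto
  then obtain v where "eigenvector A v c" unfolding spectrum_def eigenvalue_def by auto
  then have v: "v \<in> carrier_vec ?n" "v \<noteq> 0\<^sub>v ?n" "A *\<^sub>v v = c \<cdot>\<^sub>v v"
    unfolding eigenvector_def using A by auto
  obtain W k where W: "unitary_mat ?n W" "\<And>i. i < ?n \<Longrightarrow> W $$ (i, 0) = k * v $ i"
    using unitary_extending_unit_vector[OF v(1,2)] by blast
  note cW = unitary_matD(1)[OF W(1)]
  have Av: "(\<Sum>j<?n. A $$ (i, j) * v $ j) = c * v $ i" if "i < ?n" for i
  proof -
    have "(A *\<^sub>v v) $ i = (\<Sum>j<?n. A $$ (i, j) * v $ j)"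
      using A v(1) that by (simp add: scalar_prod_def atLeast0LessThan del: sum.lessThan_Suc)
    then show ?thesis using v(1,3) that by simp
  qed
  let ?B = "mat_adjoint W * A * W"
  have B0: "?B $$ (i, 0) = (if i = 0 then c else 0)" if i: "i < ?n" for i
  proof -
    have "?B = mat_adjoint W * (A * W)" using A(1) cW by (simp add: mult_assoc_square[of _ ?n] mult_closed_square[of _ ?n])
    also have "\<dots> $$ (i, 0) = (\<Sum>l<?n. mat_adjoint W $$ (i, l) * (A * W) $$ (l, 0))"
      using A(1) cW i by (intro mat_mult_index[of _ ?n]) (auto intro: mult_carrier_mat)
    also have "\<dots> = (\<Sum>l<?n. cnj (W $$ (l, i)) * (c * W $$ (l, 0)))"
    proof (intro sum.cong refl)
      fix l assume "l \<in> {..<?n}"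
      then have l: "l < ?n" by simp
      have "(A * W) $$ (l, 0) = (\<Sum>j<?n. A $$ (l, j) * W $$ (j, 0))"
        using A(1) cW l by (intro mat_mult_index[of _ ?n]) auto
      also have "\<dots> = k * (\<Sum>j<?n. A $$ (l, j) * v $ j)"
        unfolding sum_distrib_left by (intro sum.cong refl) (simp add: W(2))
      also have "\<dots> = c * W $$ (l, 0)" by (simp add: Av[OF l] W(2)[OF l] del: sum.lessThan_Suc)
      finally show "mat_adjoint W $$ (i, l) * (A * W) $$ (l, 0) = cnj (W $$ (l, i)) * (c * W $$ (l, 0))"
        using cW l i by simp
    qed
    also have "\<dots> = c * (\<Sum>l<?n. cnj (W $$ (l, i)) * W $$ (l, 0))"
      unfolding sum_distrib_left by (intro sum.cong refl) simp
    finally show ?thesis using unitary_columns[OF W(1) i, of 0] by simp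
  qed
  have "mat_adjoint ?B = ?B"
  proof -
    have "mat_adjoint ?B = mat_adjoint W * mat_adjoint (mat_adjoint W * A)"
      using A(1) cW by (intro mat_adjoint_mult[of _ ?n ?n _ ?n]) (auto intro: mult_carrier_mat)
    also have "mat_adjoint (mat_adjoint W * A) = A * W"
      using A cW by (subst mat_adjoint_mult[of _ ?n ?n _ ?n]) auto
    finally show ?thesis using A(1) cW by (simp add: mult_assoc_square[of _ ?n] mult_closed_square[of _ ?n])
  qed
  then have "?B $$ (0, 0) = cnj (?B $$ (0, 0))"
    using mat_adjoint_index[of 0 ?B 0] A(1) cW by simp
  then have "c = cnj c" using B0[of 0] by simp
  then have "c = complex_of_real (Re c)" by (simp add: complex_eq_iff)
  then show thesis using that[OF W(1), of "Re c"] B0 by metis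
qed

text \<open>Induction on the size: after deflation the first row vanishes outside the corner as well, by
  symmetry, and the remaining block is a smaller Hermitian matrix.\<close>

theorem hermitian_diagonalisation:
  assumes "A \<in> carrier_mat m m" "mat_adjoint A = A"
  shows "\<exists>U d. unitary_mat m U \<and> A = udiag m U d"
  using assms
proof (induction m arbitrary: A)
  case 0
  have "unitary_mat 0 (1\<^sub>m 0)" by (rule unitary_matI) auto
  moreover have "A = udiag 0 (1\<^sub>m 0) (\<lambda>_. 0)" using 0 by (intro eq_matI) auto
  ultimately show ?case by blast
next
  case (Suc m)
  let ?n = "Suc m"
  note A = Suc.prems
  obtain W e where W: "unitary_mat ?n W"
    and B0: "\<And>i. i < ?n \<Longrightarrow> (mat_adjoint W * A * W) $$ (i, 0) = (if i = 0 then complex_of_real e else 0)"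
    using hermitian_deflation[OF A] by blast
  note cW = unitary_matD[OF W]
  define B where "B = mat_adjoint W * A * W"
  have cB: "B \<in> carrier_mat ?n ?n" unfolding B_def using A cW by (auto intro!: mult_carrier_mat[of _ ?n ?n])
  have adjB: "mat_adjoint B = B"
  proof -
    have "mat_adjoint B = mat_adjoint W * mat_adjoint (mat_adjoint W * A)"
      unfolding B_def using A(1) cW by (intro mat_adjoint_mult[of _ ?n ?n _ ?n]) (auto intro: mult_carrier_mat)
    also have "mat_adjoint (mat_adjoint W * A) = A * W"
      using A cW by (subst mat_adjoint_mult[of _ ?n ?n _ ?n]) auto
    finally show ?thesis unfolding B_def using A(1) cW by (simp add: mult_assoc_square[of _ ?n] mult_closed_square[of _ ?n])
  qed
  have Bsym: "B $$ (i, j) = cnj (B $$ (j, i))" if "i < ?n" "j < ?n" for i j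
    using mat_adjoint_index[of i B j] cB adjB that by simp
  define C where "C = Matrix.mat m m (\<lambda>(i, j). B $$ (Suc i, Suc j))"
  have cC: "C \<in> carrier_mat m m" by (simp add: C_def)
  have "mat_adjoint C = C"
  proof (rule eq_matI)
    fix i j assume "i < dim_row C" "j < dim_col C"
    then have "i < m" "j < m" by (auto simp: C_def)
    then show "mat_adjoint C $$ (i, j) = C $$ (i, j)"
      using Bsym[of "Suc i" "Suc j"] by (simp add: C_def)
  qed (use cC in auto)
  from Suc.IH[OF cC this] obtain U' d' where U': "unitary_mat m U'" "C = udiag m U' d'" by (elim exE conjE)
  note cU' = unitary_matD(1)[OF U'(1)]
  define U where "U = Matrix.mat ?n ?n (\<lambda>(i, j). case (i, j) of (0, 0) \<Rightarrow> 1 | (Suc i, Suc j) \<Rightarrow> U' $$ (i, j) | _ \<Rightarrow> 0)"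
  define d where "d i = (case i of 0 \<Rightarrow> e | Suc i \<Rightarrow> d' i)" for i
  have cU: "U \<in> carrier_mat ?n ?n" by (simp add: U_def)
  have U_idx [simp]: "U $$ (0, 0) = 1" "\<And>i. i < m \<Longrightarrow> U $$ (Suc i, 0) = 0" "\<And>i. i < m \<Longrightarrow> U $$ (0, Suc i) = 0"
    "\<And>i j. i < m \<Longrightarrow> j < m \<Longrightarrow> U $$ (Suc i, Suc j) = U' $$ (i, j)"
    by (auto simp: U_def)
  have U: "unitary_mat ?n U"
  proof (rule unitary_matI[OF cU])
    fix i j assume ij: "i < ?n" "j < ?n"
    show "(\<Sum>l<?n. cnj (U $$ (l, i)) * U $$ (l, j)) = (if i = j then 1 else 0)"
      using ij unitary_columns[OF U'(1), of "i - 1" "j - 1"]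
      by (cases i; cases j) (auto simp: sum.lessThan_Suc_shift simp del: sum.lessThan_Suc)
  qed
  have "B = udiag ?n U d"
  proof (rule eq_matI)
    fix i j assume "i < dim_row (udiag ?n U d)" "j < dim_col (udiag ?n U d)"
    then have ij: "i < ?n" "j < ?n" using cU by auto
    have B00: "B $$ (0, 0) = complex_of_real e" and Bi0: "\<And>i. i < m \<Longrightarrow> B $$ (Suc i, 0) = 0"
      using B0 by (auto simp: B_def)
    have B0i: "B $$ (0, Suc i) = 0" if "i < m" for i using Bsym[of 0 "Suc i"] Bi0[OF that] that by simp
    have BC: "B $$ (Suc i, Suc j) = (\<Sum>l<m. complex_of_real (d' l) * (U' $$ (i, l) * cnj (U' $$ (j, l))))"
      if "i < m" "j < m" for i j
    proof -
      have "B $$ (Suc i, Suc j) = C $$ (i, j)" using that by (simp add: C_def)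
      then show ?thesis unfolding U'(2) using that cU' by (simp add: udiag_index)
    qed
    show "B $$ (i, j) = udiag ?n U d $$ (i, j)"
      unfolding udiag_index[OF cU ij] using ij B00 Bi0 B0i BC
      by (cases i; cases j) (auto simp: sum.lessThan_Suc_shift d_def simp del: sum.lessThan_Suc)
  qed (use cB cU in auto)
  moreover have "A = W * B * mat_adjoint W"
  proof -
    show ?thesis
      unfolding B_def using A(1) cW
      by (simp add: mult_assoc_square[of _ ?n] mult_closed_square[of _ ?n] unitary_cancel[OF W])
  qed
  ultimately have "A = udiag ?n (W * U) d" using udiag_conjugate[OF cW(1) cU] by simp
  then show ?case using unitary_mat_mult[OF W U] by blast
qed

text \<open>Permuting the columns of \<open>U\<close> puts the eigenvalues into any desired order.  The order by a key is
  what the comparison of \<open>f(\<psi>(X))\<close> with \<open>\<psi>(Y)\<close> needs: \<open>X\<close> is diagonalised so that the values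
  \<open>f(\<psi>(x\<^sub>i))\<close>, rather than the \<open>x\<^sub>i\<close>, increase.\<close>

lemma hermitian_diagonalisation_sorted:
  fixes key :: "real \<Rightarrow> real"
  assumes A: "A \<in> carrier_mat m m" "mat_adjoint A = A"
  obtains U d where "unitary_mat m U" "A = udiag m U d"
    "\<And>i j. i \<le> j \<Longrightarrow> j < m \<Longrightarrow> key (d i) \<le> key (d j)"
proof -
  obtain V e where V: "unitary_mat m V" "A = udiag m V e" using hermitian_diagonalisation[OF A] by blast
  note cV = unitary_matD(1)[OF V(1)]
  define xs where "xs = sort_key (\<lambda>i. key (e i)) [0..<m]"
  have xs: "length xs = m" "distinct xs" "set xs = {..<m}" "sorted (map (\<lambda>i. key (e i)) xs)"
    unfolding xs_def by (auto simp: atLeast0LessThan)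
  have bij: "bij_betw (\<lambda>i. xs ! i) {..<m} {..<m}"
    using bij_betw_nth[OF xs(2)] xs(1,3) by simp
  have lt: "xs ! i < m" if "i < m" for i using that xs(1,3) nth_mem[of i xs] by auto
  define U where "U = Matrix.mat m m (\<lambda>(i, j). V $$ (i, xs ! j))"
  have cU: "U \<in> carrier_mat m m" by (simp add: U_def)
  have "unitary_mat m U"
  proof (rule unitary_matI[OF cU])
    fix i j assume ij: "i < m" "j < m"
    have "xs ! i = xs ! j \<longleftrightarrow> i = j" using ij xs nth_eq_iff_index_eq by blast
    then show "(\<Sum>l<m. cnj (U $$ (l, i)) * U $$ (l, j)) = (if i = j then 1 else 0)"
      using unitary_columns[OF V(1) lt[OF ij(1)] lt[OF ij(2)]] ij by (simp add: U_def)
  qed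
  moreover have "A = udiag m U (\<lambda>i. e (xs ! i))"
  proof (rule eq_matI)
    fix i j assume "i < dim_row (udiag m U (\<lambda>i. e (xs ! i)))" "j < dim_col (udiag m U (\<lambda>i. e (xs ! i)))"
    then have ij: "i < m" "j < m" using cU by auto
    have "(\<Sum>l<m. complex_of_real (e l) * (V $$ (i, l) * cnj (V $$ (j, l))))
       = (\<Sum>l<m. complex_of_real (e (xs ! l)) * (V $$ (i, xs ! l) * cnj (V $$ (j, xs ! l))))"
      by (rule sum.reindex_bij_betw[OF bij, symmetric])
    then show "A $$ (i, j) = udiag m U (\<lambda>i. e (xs ! i)) $$ (i, j)"
      using ij cU cV V(2) by (simp add: udiag_index) (simp add: U_def)
  qed (use A cU in auto)
  moreover have "key (e (xs ! i)) \<le> key (e (xs ! j))" if "i \<le> j" "j < m" for i j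
    using xs(4) that xs(1) by (auto simp: sorted_iff_nth_mono)
  ultimately show thesis by (rule that)
qed

lemma hermitian_mats_diagonalisation:
  assumes "A \<in> hermitian_mats m \<Omega>"
  obtains U d where "unitary_mat m U" "A = udiag m U d" "\<And>i. i < m \<Longrightarrow> d i \<in> \<Omega>"
proof -
  have "A \<in> carrier_mat m m" "mat_adjoint A = A" using assms by (auto simp: hermitian_mats_def)
  then obtain U d where U: "unitary_mat m U" "A = udiag m U d" using hermitian_diagonalisation by blast
  then show thesis using that udiag_in_hermitian_mats_iff[OF U(1)] assms by blast
qed

lemma qform_psd_nonneg:
  assumes "A \<in> psd_mats m"
  shows "0 \<le> Re (qform m A x)"
proof -
  obtain U d where U: "unitary_mat m U" "A = udiag m U d" "\<And>i. i < m \<Longrightarrow> d i \<in> {0..}"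
    using hermitian_mats_diagonalisation[OF assms] by blast
  then show ?thesis unfolding U(2) qform_udiag[OF unitary_matD(1)[OF U(1)]] Re_complex_of_real
    by (intro sum_nonneg mult_nonneg_nonneg) auto
qed

text \<open>A vanishing diagonal value is an eigenvalue 0, whose eigenvector lies in the kernel.\<close>

lemma invertible_udiag_nonzero:
  assumes U: "unitary_mat n U" and inv: "invertible_mat (udiag n U z)" and k: "k < n"
  shows "z k \<noteq> 0"
proof
  assume "z k = 0"
  then have "0 \<in> spectrum (udiag n U z)" unfolding spectrum_udiag[OF U] using k by force
  then obtain v where v: "v \<in> carrier_vec n" "v \<noteq> 0\<^sub>v n" "udiag n U z *\<^sub>v v = 0 \<cdot>\<^sub>v v"
    using unitary_matD(1)[OF U] unfolding spectrum_def eigenvalue_def eigenvector_def by auto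
  note c = udiag_carrier[OF unitary_matD(1)[OF U], of z]
  obtain B where B: "inverts_mat (udiag n U z) B" "inverts_mat B (udiag n U z)"
    using inv unfolding invertible_mat_def by blast
  have dimB: "B \<in> carrier_mat n n"
  proof (rule carrier_matI)
    show "dim_row B = n" using arg_cong[OF B(2)[unfolded inverts_mat_def], of dim_col] c by simp
    show "dim_col B = n" using arg_cong[OF B(1)[unfolded inverts_mat_def], of dim_col] c by simp
  qed
  have "v = (B * udiag n U z) *\<^sub>v v" using B(2) dimB v(1) unfolding inverts_mat_def by simp
  also have "\<dots> = B *\<^sub>v (udiag n U z *\<^sub>v v)" using dimB c v(1) by (rule assoc_mult_mat_vec)
  also have "udiag n U z *\<^sub>v v = 0\<^sub>v n" unfolding v(3) using v(1) by auto
  also have "B *\<^sub>v 0\<^sub>v n = 0\<^sub>v n" using dimB by auto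
  finally show False using v(2) by simp
qed

section \<open>Spectral weights of a positive linear map\<close>

text \<open>The orthogonal projection onto the line spanned by column \<open>k\<close> of \<open>U\<close>.\<close>

definition eigenprojection :: "nat \<Rightarrow> complex mat \<Rightarrow> nat \<Rightarrow> complex mat" where
  "eigenprojection n U k = udiag n U (\<lambda>l. if l = k then 1 else 0)"

lemma positive_linear_mapD:
  assumes "positive_linear_map n m E"
  shows "A \<in> carrier_mat n n \<Longrightarrow> E A \<in> carrier_mat m m"
    "A \<in> carrier_mat n n \<Longrightarrow> B \<in> carrier_mat n n \<Longrightarrow> E (A + B) = E A + E B"
    "A \<in> carrier_mat n n \<Longrightarrow> E (c \<cdot>\<^sub>m A) = c \<cdot>\<^sub>m E A"
    "A \<in> psd_mats n \<Longrightarrow> E A \<in> psd_mats m"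
  using assms unfolding positive_linear_map_def by blast+

text \<open>Linearity of \<open>E\<close> on a spectral decomposition, stated entrywise so that finite sums of complex
  numbers replace finite sums of matrices.  The induction switches on one diagonal value at a time.\<close>

lemma linear_map_udiag_index:
  assumes E: "positive_linear_map n m E" and U: "unitary_mat n U" and ij: "i < m" "j < m"
  shows "E (udiag n U a) $$ (i, j)
    = (\<Sum>k<n. complex_of_real (a k) * E (eigenprojection n U k) $$ (i, j))"
proof -
  note ED = positive_linear_mapD[OF E]
  note cU [simp] = unitary_matD(1)[OF U]
  have "E (udiag n U (\<lambda>l. if l < K then a l else 0)) $$ (i, j)
    = (\<Sum>k<K. complex_of_real (a k) * E (eigenprojection n U k) $$ (i, j))" for K
  proof (induction K)
    case 0
    have "udiag n U (\<lambda>l. 0) = complex_of_real 0 \<cdot>\<^sub>m udiag n U (\<lambda>l. 0)"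
      by (subst udiag_smult) auto
    then have "E (udiag n U (\<lambda>l. 0)) = complex_of_real 0 \<cdot>\<^sub>m E (udiag n U (\<lambda>l. 0))"
      using ED(3) udiag_carrier[OF cU] by metis
    moreover have "\<dots> $$ (i, j) = 0" using carrier_matD[OF ED(1)[OF udiag_carrier[OF cU]]] ij by simp
    ultimately show ?case by simp
  next
    case (Suc K)
    have "udiag n U (\<lambda>l. if l < Suc K then a l else 0)
      = udiag n U (\<lambda>l. (if l < K then a l else 0) + a K * (if l = K then 1 else 0))"
      by (rule udiag_cong) (auto simp: less_Suc_eq)
    also have "\<dots> = udiag n U (\<lambda>l. if l < K then a l else 0) + complex_of_real (a K) \<cdot>\<^sub>m eigenprojection n U K"
      unfolding eigenprojection_def udiag_smult[OF cU] udiag_add[OF cU] ..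
    also have "E \<dots> = E (udiag n U (\<lambda>l. if l < K then a l else 0)) + complex_of_real (a K) \<cdot>\<^sub>m E (eigenprojection n U K)"
      unfolding eigenprojection_def by (simp add: ED(2,3))
    also have "\<dots> $$ (i, j) = E (udiag n U (\<lambda>l. if l < K then a l else 0)) $$ (i, j)
        + complex_of_real (a K) * E (eigenprojection n U K) $$ (i, j)"
      using ED(1)[of "eigenprojection n U K"] ED(1)[of "udiag n U (\<lambda>l. if l < K then a l else 0)"] ij
      by (simp add: eigenprojection_def)
    finally show ?case using Suc.IH by simp
  qed
  moreover have "udiag n U (\<lambda>l. if l < n then a l else 0) = udiag n U a" by (rule udiag_cong) auto
  ultimately show ?thesis by metis
qed

lemma eigenprojection_psd: "unitary_mat n U \<Longrightarrow> eigenprojection n U k \<in> psd_mats n"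
  unfolding eigenprojection_def by (simp add: udiag_in_hermitian_mats_iff)

text \<open>Positive maps preserve Hermitian matrices, since these are real combinations of positive
  semidefinite ones.\<close>

lemma positive_map_udiag_hermitian:
  assumes E: "positive_linear_map n m E" and U: "unitary_mat n U"
  shows "E (udiag n U a) \<in> carrier_mat m m" "mat_adjoint (E (udiag n U a)) = E (udiag n U a)"
proof -
  note ED = positive_linear_mapD[OF E]
  show c: "E (udiag n U a) \<in> carrier_mat m m" by (rule ED(1)[OF udiag_carrier[OF unitary_matD(1)[OF U]]])
  have P: "E (eigenprojection n U k) $$ (i, j) = cnj (E (eigenprojection n U k) $$ (j, i))"
    if "i < m" "j < m" for i j k
  proof -
    have "E (eigenprojection n U k) \<in> psd_mats m" by (intro ED(4) eigenprojection_psd U)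
    then have "E (eigenprojection n U k) \<in> carrier_mat m m"
      "mat_adjoint (E (eigenprojection n U k)) = E (eigenprojection n U k)"
      unfolding hermitian_mats_def by auto
    then show ?thesis using mat_adjoint_index[of i "E (eigenprojection n U k)" j] that by auto
  qed
  show "mat_adjoint (E (udiag n U a)) = E (udiag n U a)"
  proof (rule eq_matI)
    fix i j assume "i < dim_row (E (udiag n U a))" "j < dim_col (E (udiag n U a))"
    then have ij: "i < m" "j < m" using c by auto
    have "mat_adjoint (E (udiag n U a)) $$ (i, j) = cnj (E (udiag n U a) $$ (j, i))"
      using c ij by simp
    also have "\<dots> = (\<Sum>k<n. complex_of_real (a k) * cnj (E (eigenprojection n U k) $$ (j, i)))"
      unfolding linear_map_udiag_index[OF E U ij(2,1)] by simp
    also have "\<dots> = E (udiag n U a) $$ (i, j)"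
      unfolding linear_map_udiag_index[OF E U ij] P[OF ij, symmetric] ..
    finally show "mat_adjoint (E (udiag n U a)) $$ (i, j) = E (udiag n U a) $$ (i, j)" .
  qed (use c in auto)
qed

text \<open>The mass at the \<open>k\<close>-th eigenvalue of the spectral measure that \<open>E\<close> and the vector \<open>h\<close> induce.\<close>

definition weight :: "nat \<Rightarrow> nat \<Rightarrow> (complex mat \<Rightarrow> complex mat) \<Rightarrow> complex mat \<Rightarrow> (nat \<Rightarrow> complex) \<Rightarrow> nat \<Rightarrow> real" where
  "weight n m E U h k = Re (qform m (E (eigenprojection n U k)) h)"

lemma weight_nonneg:
  assumes E: "positive_linear_map n m E" and U: "unitary_mat n U"
  shows "0 \<le> weight n m E U h k"
  unfolding weight_def
  by (intro qform_psd_nonneg positive_linear_mapD(4)[OF E] eigenprojection_psd U)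

text \<open>The quadratic form of \<open>E\<close> of a function of \<open>Z\<close> is the integral of that function against a single family
  of weights, which depends on \<open>h\<close> but not on the function.  This turns an operator inequality into
  a scalar one.\<close>

lemma qform_linear_map_udiag:
  assumes E: "positive_linear_map n m E" and U: "unitary_mat n U"
  shows "Re (qform m (E (udiag n U a)) h) = (\<Sum>k<n. a k * weight n m E U h k)"
proof -
  have "qform m (E (udiag n U a)) h
    = (\<Sum>i<m. \<Sum>j<m. \<Sum>k<n. complex_of_real (a k) * (cnj (h i) * E (eigenprojection n U k) $$ (i, j) * h j))"
    unfolding qform_def
  proof (intro sum.cong refl)
    fix i j assume "i \<in> {..<m}" "j \<in> {..<m}"
    then have "E (udiag n U a) $$ (i, j) = (\<Sum>k<n. complex_of_real (a k) * E (eigenprojection n U k) $$ (i, j))"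
      by (intro linear_map_udiag_index[OF E U]) auto
    then show "cnj (h i) * E (udiag n U a) $$ (i, j) * h j
      = (\<Sum>k<n. complex_of_real (a k) * (cnj (h i) * E (eigenprojection n U k) $$ (i, j) * h j))"
      by (simp add: sum_distrib_left sum_distrib_right mult_ac)
  qed
  also have "\<dots> = (\<Sum>i<m. \<Sum>k<n. \<Sum>j<m. complex_of_real (a k) * (cnj (h i) * E (eigenprojection n U k) $$ (i, j) * h j))"
    by (intro sum.cong refl sum.swap)
  also have "\<dots> = (\<Sum>k<n. \<Sum>i<m. \<Sum>j<m. complex_of_real (a k) * (cnj (h i) * E (eigenprojection n U k) $$ (i, j) * h j))"
    by (rule sum.swap)
  also have "\<dots> = (\<Sum>k<n. complex_of_real (a k) * qform m (E (eigenprojection n U k)) h)"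
    unfolding qform_def by (simp add: sum_distrib_left)
  finally show ?thesis by (simp add: weight_def)
qed

lemma sum_weight:
  assumes E: "positive_linear_map n m E" and U: "unitary_mat n U"
  shows "(\<Sum>k<n. weight n m E U h k) = Re (qform m (E (1\<^sub>m n)) h)"
  using qform_linear_map_udiag[OF E U, of "\<lambda>_. 1" h] unfolding udiag_const_one[OF U] by simp

lemma sum_weight_unital:
  assumes E: "positive_linear_map n m E" "unital_map n m E" and U: "unitary_mat n U"
  shows "(\<Sum>k<n. weight n m E U h k) = (\<Sum>i<m. (cmod (h i))\<^sup>2)"
  using sum_weight[OF E(1) U, of h] E(2) unfolding unital_map_def by (simp add: qform_one)

lemma sum_weight_sub_unital:
  assumes E: "positive_linear_map n m E" "sub_unital_map n m E" and U: "unitary_mat n U"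
  shows "(\<Sum>k<n. weight n m E U h k) \<le> (\<Sum>i<m. (cmod (h i))\<^sup>2)"
proof -
  have c: "E (1\<^sub>m n) \<in> carrier_mat m m" and psd: "1\<^sub>m m - E (1\<^sub>m n) \<in> psd_mats m"
    using E(2) unfolding sub_unital_map_def loewner_le_def by auto
  have "qform m (1\<^sub>m m - E (1\<^sub>m n)) h = qform m (1\<^sub>m m) h - qform m (E (1\<^sub>m n)) h"
    unfolding qform_def sum_subtractf[symmetric] using c
    by (intro sum.cong refl) (simp add: ring_distribs)
  then show ?thesis using qform_psd_nonneg[OF psd, of h] sum_weight[OF E(1) U, of h] by (simp add: qform_one)
qed

section \<open>From quadratic forms to eigenvalues\<close>

text \<open>Compare with the threshold \<open>t = L (k - 1)\<close>: each product \<open>(c l - ind l) * (L l - t)\<close> has factors of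
  equal sign, and the total weights agree.  For \<open>k = 0\<close> the truncated index is 0, which still
  is a valid threshold as \<open>L 0\<close> is the smallest value.\<close>

lemma sum_smallest_le_weighted_sum:
  fixes L c :: "nat \<Rightarrow> real"
  assumes mono: "\<And>i j. i \<le> j \<Longrightarrow> j < m \<Longrightarrow> L i \<le> L j"
    and c: "\<And>l. l < m \<Longrightarrow> 0 \<le> c l" "\<And>l. l < m \<Longrightarrow> c l \<le> 1" "(\<Sum>l<m. c l) = real k" and k: "k \<le> m"
  shows "(\<Sum>l<k. L l) \<le> (\<Sum>l<m. c l * L l)"
proof -
  define t where "t = L (k - 1)"
  define ind where "ind l = (if l < k then 1 else 0 :: real)" for l
  have restrict: "(\<Sum>l<m. ind l * g l) = (\<Sum>l<k. g l)" for g
    using k by (intro sum.mono_neutral_cong_right) (auto simp: ind_def)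
  have "0 \<le> (\<Sum>l<m. (c l - ind l) * (L l - t))"
  proof (intro sum_nonneg)
    fix l assume "l \<in> {..<m}"
    then have l: "l < m" by simp
    show "0 \<le> (c l - ind l) * (L l - t)"
    proof (cases "l < k")
      case True
      then have "L l \<le> t" unfolding t_def using k by (intro mono) auto
      then show ?thesis using True c(2)[OF l] by (auto simp: ind_def intro: mult_nonpos_nonpos)
    next
      case False
      then have "t \<le> L l" unfolding t_def using l by (intro mono) auto
      then show ?thesis using False c(1)[OF l] by (auto simp: ind_def)
    qed
  qed
  also have "\<dots> = (\<Sum>l<m. c l * L l) - (\<Sum>l<m. ind l * L l) - t * ((\<Sum>l<m. c l) - (\<Sum>l<m. ind l * 1))"
    by (simp add: algebra_simps sum.distrib sum_subtractf sum_distrib_left)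
  finally show ?thesis unfolding restrict c(3) by simp
qed

text \<open>The first \<open>k\<close> columns of a doubly stochastic matrix add up to weights in \<open>[0, 1]\<close> of total weight
  \<open>k\<close>, to which the preceding lemma applies after taking logarithms.  If the smallest value is 0, the
  left-hand product is 0.\<close>

lemma prod_smallest_le_prod:
  fixes a b :: "nat \<Rightarrow> real" and P :: "nat \<Rightarrow> nat \<Rightarrow> real"
  assumes b: "\<And>l. l < m \<Longrightarrow> 0 \<le> b l" "\<And>i j. i \<le> j \<Longrightarrow> j < m \<Longrightarrow> b i \<le> b j"
    and a: "\<And>j. j < m \<Longrightarrow> 0 \<le> a j"
    and P: "\<And>l j. 0 \<le> P l j" "\<And>l. l < m \<Longrightarrow> (\<Sum>j<m. P l j) = 1" "\<And>j. j < m \<Longrightarrow> (\<Sum>l<m. P l j) = 1"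
    and geo: "\<And>j. j < m \<Longrightarrow> (\<And>l. l < m \<Longrightarrow> 0 < b l) \<Longrightarrow> exp (\<Sum>l<m. P l j * ln (b l)) \<le> a j"
    and k: "k \<le> m"
  shows "(\<Prod>l<k. b l) \<le> (\<Prod>j<k. a j)"
proof (cases "k = 0 \<or> b 0 = 0")
  case True
  then show ?thesis
  proof
    assume b0: "b 0 = 0"
    show ?thesis
    proof (cases "k = 0")
      case False
      then have "(\<Prod>l<k. b l) = 0" using b0 by (auto intro: prod_zero)
      also have "\<dots> \<le> (\<Prod>j<k. a j)" using a k by (intro prod_nonneg) auto
      finally show ?thesis .
    qed simp
  qed simp
next
  case False
  then have "0 < m" using k by simp
  then have "0 < b 0" using False b(1)[of 0] by simp
  then have pos: "0 < b l" if "l < m" for l using b(2)[of 0 l] that by simp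
  define c where "c l = (\<Sum>j<k. P l j)" for l
  have "(\<Sum>l<k. ln (b l)) \<le> (\<Sum>l<m. c l * ln (b l))"
  proof (rule sum_smallest_le_weighted_sum[OF _ _ _ _ k])
    show "ln (b i) \<le> ln (b j)" if "i \<le> j" "j < m" for i j
      using b(2)[OF that] pos[of i] pos[of j] that by simp
    show "0 \<le> c l" for l unfolding c_def using P(1) by (intro sum_nonneg) auto
    show "c l \<le> 1" if "l < m" for l
      unfolding c_def P(2)[OF that, symmetric] using k P(1) by (intro sum_mono2) auto
    have "(\<Sum>l<m. c l) = (\<Sum>j<k. \<Sum>l<m. P l j)" unfolding c_def by (rule sum.swap)
    also have "\<dots> = (\<Sum>j<k. 1)" using k by (intro sum.cong refl P(3)) auto
    finally show "(\<Sum>l<m. c l) = real k" by simp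
  qed
  also have "\<dots> = (\<Sum>j<k. \<Sum>l<m. P l j * ln (b l))"
    unfolding c_def sum_distrib_right by (rule sum.swap)
  finally have "exp (\<Sum>l<k. ln (b l)) \<le> exp (\<Sum>j<k. \<Sum>l<m. P l j * ln (b l))" by simp
  moreover have "exp (\<Sum>l<k. ln (b l)) = (\<Prod>l<k. b l)"
    using pos k by (simp add: exp_sum)
  moreover have "exp (\<Sum>j<k. \<Sum>l<m. P l j * ln (b l)) \<le> (\<Prod>j<k. a j)"
  proof -
    have "exp (\<Sum>j<k. \<Sum>l<m. P l j * ln (b l)) = (\<Prod>j<k. exp (\<Sum>l<m. P l j * ln (b l)))"
      by (rule exp_sum) simp
    also have "\<dots> \<le> (\<Prod>j<k. a j)"
      using k by (intro prod_mono conjI less_imp_le[OF exp_gt_zero] geo pos) auto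
    finally show ?thesis .
  qed
  ultimately show ?thesis by simp
qed

text \<open>The conditions on \<open>h\<close> are \<open>m - 1\<close> linear equations in \<open>m\<close> unknowns.  Completing them by a zero row
  gives a square matrix of determinant 0, whose kernel contains a nonzero vector.\<close>

lemma common_unit_vector:
  assumes V: "unitary_mat m V" and W: "unitary_mat m W" and k: "k < m"
  obtains h where "(\<Sum>i<m. (cmod (h i))\<^sup>2) = 1"
    "\<And>l. l < k \<Longrightarrow> coord m V h l = 0" "\<And>j. k < j \<Longrightarrow> j < m \<Longrightarrow> coord m W h j = 0"
proof -
  define r where "r j = (if j < k then vec m (\<lambda>i. cnj (V $$ (i, j))) else vec m (\<lambda>i. cnj (W $$ (i, j))))" for j
  have r: "r j \<in> carrier_vec m" for j by (simp add: r_def)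
  define M where "M = mat\<^sub>r m m (\<lambda>j. if j = k then 0\<^sub>v m else r j)"
  have M: "M \<in> carrier_mat m m" by (simp add: M_def)
  have "det M = 0" unfolding M_def using k r by (intro det_row_0) auto
  then obtain v where v: "v \<in> carrier_vec m" "v \<noteq> 0\<^sub>v m" "M *\<^sub>v v = 0\<^sub>v m"
    using det_0_iff_vec_prod_zero_field[OF M] by blast
  have rv: "r j \<bullet> v = 0" if "j < m" "j \<noteq> k" for j
  proof -
    have "(M *\<^sub>v v) $ j = row M j \<bullet> v" using M that by simp
    also have "row M j = r j" using that r unfolding M_def by simp
    finally show ?thesis using v(3) that by simp
  qed
  define N where "N = (\<Sum>i<m. (cmod (v $ i))\<^sup>2)"
  obtain i0 where i0: "i0 < m" "v $ i0 \<noteq> 0" using v(1,2) by (metis carrier_vecD eq_vecI index_zero_vec)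
  have "0 < N" unfolding N_def using i0 by (intro sum_pos2[of _ i0]) auto
  define h where "h i = complex_of_real (1 / sqrt N) * v $ i" for i
  have coordh: "coord m U h l = complex_of_real (1 / sqrt N) * (\<Sum>i<m. cnj (U $$ (i, l)) * v $ i)" for U l
    unfolding coord_def h_def sum_distrib_left by (intro sum.cong refl) simp
  show thesis
  proof (rule that[of h])
    have "(\<Sum>i<m. (cmod (h i))\<^sup>2) = (1 / sqrt N)\<^sup>2 * N"
      unfolding h_def N_def norm_mult power_mult_distrib sum_distrib_left norm_of_real power2_abs ..
    then show "(\<Sum>i<m. (cmod (h i))\<^sup>2) = 1" using \<open>0 < N\<close> by (simp add: power_divide)
    show "coord m V h l = 0" if "l < k" for l
    proof -
      have "r l \<bullet> v = (\<Sum>i<m. cnj (V $$ (i, l)) * v $ i)"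
        using v(1) that by (simp add: r_def scalar_prod_def atLeast0LessThan)
      then show ?thesis unfolding coordh using rv[of l] that k by simp
    qed
    show "coord m W h j = 0" if "k < j" "j < m" for j
    proof -
      have "r j \<bullet> v = (\<Sum>i<m. cnj (W $$ (i, j)) * v $ i)"
        using v(1) that by (simp add: r_def scalar_prod_def atLeast0LessThan)
      then show ?thesis unfolding coordh using rv[of j] that k by simp
    qed
  qed
qed

lemma wlog_major_udiag:
  assumes U: "unitary_mat m U" and V: "unitary_mat m V"
    and a: "\<And>i j. i \<le> j \<Longrightarrow> j < m \<Longrightarrow> a i \<le> a j" "\<And>i. i < m \<Longrightarrow> 0 \<le> a i"
    and b: "\<And>i j. i \<le> j \<Longrightarrow> j < m \<Longrightarrow> b i \<le> b j" "\<And>i. i < m \<Longrightarrow> 0 \<le> b i"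
    and le: "\<And>k. k \<le> m \<Longrightarrow> (\<Prod>j<k. b j) \<le> (\<Prod>j<k. a j)"
  shows "wlog_major m (udiag m U a) (udiag m V b)"
proof -
  have *: "(\<Prod>j=1..k. eig (udiag m U d) (m + 1 - j)) = (\<Prod>j<k. d j)"
    if U: "unitary_mat m U" and d: "\<And>i j. i \<le> j \<Longrightarrow> j < m \<Longrightarrow> d i \<le> d j" and k: "k \<le> m" for U d k
  proof -
    have "(\<Prod>j=1..k. eig (udiag m U d) (m + 1 - j)) = (\<Prod>j=1..k. d (j - 1))"
      using k by (intro prod.cong refl eig_udiag[OF U d]) auto
    also have "\<dots> = (\<Prod>j<k. d j)"
      by (rule prod.reindex_bij_witness[of _ Suc "\<lambda>j. j - 1"]) auto
    finally show ?thesis .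
  qed
  show ?thesis
    unfolding wlog_major_def udiag_in_hermitian_mats_iff[OF U] udiag_in_hermitian_mats_iff[OF V]
  proof (intro conjI ballI)
    fix k assume "k \<in> {1..m}"
    then have k: "k \<le> m" by simp
    show "(\<Prod>j=1..k. eig (udiag m V b) (m + 1 - j)) \<le> (\<Prod>j=1..k. eig (udiag m U a) (m + 1 - j))"
      using le[OF k] *[OF U a(1) k] *[OF V b(1) k] by simp
  qed (use a(2) b(2) in auto)
qed

text \<open>The unitary that carries the eigenbasis of the one matrix to that of the other makes both diagonal in
  the same basis.\<close>

lemma loewner_le_conjugate_udiag:
  assumes U: "unitary_mat m U" and V: "unitary_mat m V" and le: "\<And>i. i < m \<Longrightarrow> b i \<le> a i"
  shows "\<exists>Q. unitary_mat m Q \<and> loewner_le m (Q * udiag m V b * mat_adjoint Q) (udiag m U a)"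
proof (intro exI conjI)
  let ?Q = "U * mat_adjoint V"
  show Q: "unitary_mat m ?Q" by (intro unitary_mat_mult unitary_mat_adjoint U V)
  note cU = unitary_matD(1)[OF U] and cV = unitary_matD[OF V]
  have "?Q * udiag m V b * mat_adjoint ?Q = udiag m (?Q * V) b"
    by (rule udiag_conjugate[OF unitary_matD(1)[OF Q] cV(1)])
  also have "?Q * V = U" using cU cV by (simp add: mult_assoc_square[of _ m])
  finally have eq: "?Q * udiag m V b * mat_adjoint ?Q = udiag m U b" .
  show "loewner_le m (?Q * udiag m V b * mat_adjoint ?Q) (udiag m U a)"
    unfolding eq loewner_le_def udiag_minus[OF cU] udiag_in_hermitian_mats_iff[OF U]
    using le cU by auto
qed

text \<open>A weighted mean lies between two of the averaged points, and a monotone function on an interval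
  attains its maximum at one of its endpoints.\<close>

lemma monotone_weighted_mean_le:
  fixes x w :: "nat \<Rightarrow> real" and F :: "real \<Rightarrow> real"
  assumes mono: "mono_on D F \<or> antimono_on D F"
    and fin: "finite I" and w: "\<And>i. i \<in> I \<Longrightarrow> 0 \<le> w i" "sum w I = 1"
    and x: "\<And>i. i \<in> I \<Longrightarrow> x i \<in> D" and s: "(\<Sum>i\<in>I. w i * x i) \<in> D"
    and le: "\<And>i. i \<in> I \<Longrightarrow> F (x i) \<le> B"
  shows "F (\<Sum>i\<in>I. w i * x i) \<le> B"
proof -
  note wb = weighted_mean_between[where x = x and w = w, OF fin w]
  from mono show ?thesis
  proof
    assume "mono_on D F"
    moreover from wb(2) obtain i where "i \<in> I" "(\<Sum>i\<in>I. w i * x i) \<le> x i" by blast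
    ultimately show ?thesis using monotone_onD[of D "(\<le>)" "(\<le>)" F] x s le order_trans by metis
  next
    assume "antimono_on D F"
    moreover from wb(1) obtain i where "i \<in> I" "x i \<le> (\<Sum>i\<in>I. w i * x i)" by blast
    ultimately show ?thesis using monotone_onD[of D "(\<le>)" "\<lambda>x y. y \<le> x" F] x s le order_trans by metis
  qed
qed

text \<open>The hypothesis \<open>jensen\<close> relates the quadratic forms of \<open>Y = V diag(y) V*\<close> and \<open>X = W diag(x) W*\<close>
  at each unit vector.  Taking \<open>h\<close> to be the columns of \<open>W\<close> gives the log-majorisation; taking \<open>h\<close> in
  the intersection of the span of the first \<open>k + 1\<close> columns of \<open>W\<close> with the span of the columns
  of \<open>V\<close> from \<open>k\<close> on gives \<open>\<psi>(y\<^sub>k) \<le> F(x\<^sub>k)\<close>.\<close>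

theorem jensen_spectral_comparison:
  fixes F \<psi> :: "real \<Rightarrow> real" and m :: nat
  defines "rayleigh \<equiv> \<lambda>U (d :: nat \<Rightarrow> real) h. \<Sum>l<m. d l * (cmod (coord m U h l))\<^sup>2"
  assumes W: "unitary_mat m W" and V: "unitary_mat m V"
    and x: "\<And>i j. i \<le> j \<Longrightarrow> j < m \<Longrightarrow> F (x i) \<le> F (x j)"
    and y: "\<And>i j. i \<le> j \<Longrightarrow> j < m \<Longrightarrow> y i \<le> y j"
    and \<psi>: "\<And>t. 0 \<le> \<psi> t" "\<And>l t. l < m \<Longrightarrow> y l \<le> t \<Longrightarrow> \<psi> (y l) \<le> \<psi> t"
    and log_concave: "\<And>d. (\<And>l. l < m \<Longrightarrow> 0 < \<psi> (y l)) \<Longrightarrow> (\<And>l. 0 \<le> d l) \<Longrightarrow> (\<Sum>l<m. d l) = 1 \<Longrightarrow>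
      exp (\<Sum>l<m. d l * ln (\<psi> (y l))) \<le> \<psi> (\<Sum>l<m. d l * y l)"
    and jensen: "\<And>h. (\<Sum>i<m. (cmod (h i))\<^sup>2) = 1 \<Longrightarrow> \<psi> (rayleigh V y h) \<le> F (rayleigh W x h)"
    and D: "\<And>h. (\<Sum>i<m. (cmod (h i))\<^sup>2) = 1 \<Longrightarrow> rayleigh W x h \<in> D"
  shows "wlog_major m (udiag m W (\<lambda>i. F (x i))) (udiag m V (\<lambda>i. \<psi> (y i)))"
    and "mono_on D F \<or> antimono_on D F \<Longrightarrow>
      \<exists>Q. unitary_mat m Q \<and>
        loewner_le m (Q * udiag m V (\<lambda>i. \<psi> (y i)) * mat_adjoint Q) (udiag m W (\<lambda>i. F (x i)))"
proof -
  define P where "P l j = (cmod (overlap m V W l j))\<^sup>2" for l j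
  have P: "0 \<le> P l j" "l < m \<Longrightarrow> (\<Sum>j<m. P l j) = 1" "j < m \<Longrightarrow> (\<Sum>l<m. P l j) = 1" for l j
    unfolding P_def using overlap_sums[OF V W] by auto
  define col where "col j = (\<lambda>i. W $$ (i, j))" for j
  have unit: "(\<Sum>i<m. (cmod (col j i))\<^sup>2) = 1" if "j < m" for j
    unfolding col_def by (rule unitary_column_norm[OF W that])
  have rW: "rayleigh W x (col j) = x j" if "j < m" for j
  proof -
    have "rayleigh W x (col j) = (\<Sum>l<m. if l = j then x l else 0)"
      unfolding rayleigh_def col_def using that
      by (intro sum.cong refl) (simp add: overlap_same[OF W, unfolded overlap_def])
    then show ?thesis using that by simp
  qed
  have rV: "rayleigh V y (col j) = (\<Sum>l<m. P l j * y l)" for j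
    unfolding rayleigh_def P_def overlap_def col_def by (simp add: mult.commute)
  have key: "\<psi> (\<Sum>l<m. P l j * y l) \<le> F (x j)" if "j < m" for j
    using jensen[OF unit[OF that]] unfolding rV rW[OF that] .
  have F0: "0 \<le> F (x j)" if "j < m" for j using key[OF that] \<psi>(1) order_trans by blast
  have \<psi>y: "\<psi> (y i) \<le> \<psi> (y j)" if "i \<le> j" "j < m" for i j using that \<psi>(2) y by simp
  show "wlog_major m (udiag m W (\<lambda>i. F (x i))) (udiag m V (\<lambda>i. \<psi> (y i)))"
  proof (rule wlog_major_udiag[OF W V x F0 \<psi>y \<psi>(1)])
    fix k assume k: "k \<le> m"
    show "(\<Prod>j<k. \<psi> (y j)) \<le> (\<Prod>j<k. F (x j))"
    proof (rule prod_smallest_le_prod[OF \<psi>(1) \<psi>y F0 P _ k])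
      fix j assume j: "j < m" and pos: "\<And>l. l < m \<Longrightarrow> 0 < \<psi> (y l)"
      have "exp (\<Sum>l<m. P l j * ln (\<psi> (y l))) \<le> \<psi> (\<Sum>l<m. P l j * y l)"
        by (rule log_concave[OF pos P(1) P(3)[OF j]])
      then show "exp (\<Sum>l<m. P l j * ln (\<psi> (y l))) \<le> F (x j)" using key[OF j] by simp
    qed
  qed
  assume mono: "mono_on D F \<or> antimono_on D F"
  show "\<exists>Q. unitary_mat m Q \<and>
      loewner_le m (Q * udiag m V (\<lambda>i. \<psi> (y i)) * mat_adjoint Q) (udiag m W (\<lambda>i. F (x i)))"
  proof (rule loewner_le_conjugate_udiag[OF W V])
    fix k assume k: "k < m"
    obtain h where h: "(\<Sum>i<m. (cmod (h i))\<^sup>2) = 1"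
      "\<And>l. l < k \<Longrightarrow> coord m V h l = 0" "\<And>j. k < j \<Longrightarrow> j < m \<Longrightarrow> coord m W h j = 0"
      using common_unit_vector[OF V W k] by blast
    have "y k = (\<Sum>l<m. y k * (cmod (coord m V h l))\<^sup>2)"
      by (simp add: coord_parseval[OF V] h(1) flip: sum_distrib_left)
    also have "\<dots> \<le> rayleigh V y h"
      unfolding rayleigh_def
    proof (intro sum_mono)
      fix l assume "l \<in> {..<m}"
      then show "y k * (cmod (coord m V h l))\<^sup>2 \<le> y l * (cmod (coord m V h l))\<^sup>2"
        using h(2)[of l] y[of k l] by (cases "l < k") (auto intro!: mult_right_mono)
    qed
    finally have "\<psi> (y k) \<le> \<psi> (rayleigh V y h)" by (rule \<psi>(2)[OF k])
    also have "\<dots> \<le> F (rayleigh W x h)" by (rule jensen[OF h(1)])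
    also have "\<dots> \<le> F (x k)"
    proof -
      let ?w = "\<lambda>l. (cmod (coord m W h l))\<^sup>2"
      have restrict: "(\<Sum>l<m. g l * ?w l) = (\<Sum>l\<le>k. ?w l * g l)" for g
        using k h(3) by (intro sum.mono_neutral_cong_right) (auto simp: not_le)
      have "F (\<Sum>l\<le>k. ?w l * x l) \<le> F (x k)"
      proof (rule monotone_weighted_mean_le[OF mono])
        show "sum ?w {..k} = 1" using restrict[of "\<lambda>_. 1"] coord_parseval[OF W, of h] h(1) by simp
        show "(\<Sum>l\<le>k. ?w l * x l) \<in> D" using D[OF h(1)] unfolding rayleigh_def restrict .
        show "x i \<in> D" if "i \<in> {..k}" for i
          using D[OF unit, of i] rW[of i] that k by simp
        show "F (x i) \<le> F (x k)" if "i \<in> {..k}" for i using x[of i k] that k by simp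
      qed auto
      then show ?thesis unfolding rayleigh_def restrict .
    qed
    finally show "\<psi> (y k) \<le> F (x k)" .
  qed
qed

section \<open>The geometric mean of a unital positive map\<close>

lemma entry_sq_le_frobenius_sq:
  assumes "i < m" "j < m" shows "(cmod (A $$ (i, j)))\<^sup>2 \<le> frobenius_sq m A"
proof -
  have "(cmod (A $$ (i, j)))\<^sup>2 \<le> (\<Sum>j<m. (cmod (A $$ (i, j)))\<^sup>2)"
    using assms by (intro member_le_sum) auto
  also have "\<dots> \<le> frobenius_sq m A"
    unfolding frobenius_sq_def using assms
    by (intro member_le_sum[of i _ "\<lambda>i. \<Sum>j<m. (cmod (A $$ (i, j)))\<^sup>2"]) (auto intro!: sum_nonneg)
  finally show ?thesis .
qed

text \<open>A scalar Lipschitz function is Lipschitz for the Frobenius norm on Hermitian matrices, with the same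
  constant; only the values on the two spectra matter.\<close>

lemma frobenius_sq_lipschitz:
  assumes U: "unitary_mat m U" and V: "unitary_mat m V" and "0 \<le> c"
    and lip: "\<And>l k. l < m \<Longrightarrow> k < m \<Longrightarrow> \<bar>g (a l) - g (b k)\<bar> \<le> c * \<bar>a l - b k\<bar>"
  shows "frobenius_sq m (udiag m U (\<lambda>i. g (a i)) - udiag m V (\<lambda>i. g (b i)))
    \<le> c\<^sup>2 * frobenius_sq m (udiag m U a - udiag m V b)"
  unfolding frobenius_sq_udiag_diff[OF U V] sum_distrib_left
proof (intro sum_mono)
  fix l k assume "l \<in> {..<m}" "k \<in> {..<m}"
  then have "\<bar>g (a l) - g (b k)\<bar>\<^sup>2 \<le> (c * \<bar>a l - b k\<bar>)\<^sup>2" by (intro power_mono lip) auto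
  then have "(g (a l) - g (b k))\<^sup>2 \<le> c\<^sup>2 * (a l - b k)\<^sup>2" by (simp add: power_mult_distrib)
  then have "(g (a l) - g (b k))\<^sup>2 * (cmod (overlap m U V l k))\<^sup>2
    \<le> c\<^sup>2 * (a l - b k)\<^sup>2 * (cmod (overlap m U V l k))\<^sup>2"
    by (rule mult_right_mono) simp
  then show "(g (a l) - g (b k))\<^sup>2 * (cmod (overlap m U V l k))\<^sup>2
    \<le> c\<^sup>2 * ((a l - b k)\<^sup>2 * (cmod (overlap m U V l k))\<^sup>2)"
    by (simp add: mult.assoc)
qed

text \<open>The derivative of \<open>t powr (1/p)\<close> is \<open>1/p\<close> times \<open>t powr (1/p - 1)\<close>, and for \<open>t \<le> exp (p * R)\<close> the second
  factor is at most \<open>exp R\<close>, uniformly in \<open>p\<close>.\<close>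

lemma powr_inverse_lipschitz:
  fixes s t p R :: real
  assumes p: "0 < p" "p \<le> 1" and s: "0 < s" "s \<le> exp (p * R)" and t: "0 < t" "t \<le> exp (p * R)" and R: "0 \<le> R"
  shows "\<bar>s powr (1 / p) - t powr (1 / p)\<bar> \<le> exp R / p * \<bar>s - t\<bar>"
proof -
  have *: "v powr (1 / p) - u powr (1 / p) \<le> exp R / p * (v - u)"
    if u: "0 < u" "u < v" "v \<le> exp (p * R)" for u v
  proof -
    have deriv: "((\<lambda>x. x powr (1 / p)) has_real_derivative 1 / p * t powr (1 / p - 1)) (at t)"
      if "u \<le> t" for t
      using has_real_derivative_powr[of t "1 / p"] u that by simp
    obtain z where z: "u < z" "z < v"
      "v powr (1 / p) - u powr (1 / p) = (v - u) * (1 / p * z powr (1 / p - 1))"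
      using MVT2[OF u(2) deriv] by blast
    have "z powr (1 / p - 1) \<le> exp (p * R) powr (1 / p - 1)"
      using z u p by (intro powr_mono2) auto
    also have "\<dots> = exp ((1 - p) * R)"
      using p by (simp add: powr_def field_simps)
    also have "\<dots> \<le> exp R" using p R by (simp add: mult_left_le_one_le)
    finally have "1 / p * z powr (1 / p - 1) \<le> exp R / p" using p by (simp add: field_simps)
    then have "(v - u) * (1 / p * z powr (1 / p - 1)) \<le> (v - u) * (exp R / p)"
      using u by (intro mult_left_mono) auto
    then show ?thesis unfolding z(3) by (simp add: mult.commute)
  qed
  have mono: "u powr (1 / p) \<le> v powr (1 / p)" if "0 < u" "u \<le> v" for u v
    using that p by (intro powr_mono2) auto
  consider "s < t" | "s = t" | "t < s" by linarith
  then show ?thesis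
  proof cases
    case 1
    then show ?thesis using *[of s t] mono[of s t] s t by (simp add: abs_if)
  next
    case 3
    then show ?thesis using *[of t s] mono[of t s] s t by (simp add: abs_if)
  qed simp
qed

lemma powr_difference_quotient:
  fixes z :: real
  assumes "0 < z"
  shows "((\<lambda>p. (z powr p - 1) / p) \<longlongrightarrow> ln z) (at_right 0)"
proof -
  have "((\<lambda>p. exp (p * ln z)) has_real_derivative ln z) (at 0)"
    by (auto intro!: derivative_eq_intros)
  then have "((\<lambda>p. (exp (p * ln z) - 1) / p) \<longlongrightarrow> ln z) (at 0)"
    unfolding DERIV_def by simp
  then show ?thesis
    using assms filterlim_at_split by (auto simp: powr_def)
qed

text \<open>At an eigenvector the quadratic form is an eigenvalue, hence an average of the values \<open>a\<^sub>k\<close> with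
  weights of total mass 1.\<close>

lemma eigenvalue_between:
  assumes E: "positive_linear_map n m E" "unital_map n m E" and U: "unitary_mat n U"
    and W: "unitary_mat m W" and eq: "E (udiag n U a) = udiag m W x" and j: "j < m"
  shows "\<exists>k<n. a k \<le> x j" "\<exists>k<n. x j \<le> a k"
proof -
  let ?h = "\<lambda>i. W $$ (i, j)"
  have "(\<Sum>k<n. a k * weight n m E U ?h k) = (\<Sum>l<m. x l * (cmod (overlap m W W l j))\<^sup>2)"
    unfolding qform_linear_map_udiag[OF E(1) U, symmetric] eq qform_udiag[OF unitary_matD(1)[OF W]] overlap_def
    by simp
  also have "\<dots> = (\<Sum>l<m. if l = j then x l else 0)"
    using j by (intro sum.cong refl) (simp add: overlap_same[OF W])
  finally have xj: "(\<Sum>k<n. weight n m E U ?h k * a k) = x j" using j by (simp add: mult.commute)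
  have w: "(\<Sum>k<n. weight n m E U ?h k) = 1"
    unfolding sum_weight_unital[OF E U] by (rule unitary_column_norm[OF W j])
  show "\<exists>k<n. a k \<le> x j" "\<exists>k<n. x j \<le> a k"
    using weighted_mean_between[where I = "{..<n}" and w = "weight n m E U ?h" and x = a, OF _ _ w]
      weight_nonneg[OF E(1) U] unfolding xj by auto
qed

text \<open>With \<open>M = E(Z powr p)\<close> and \<open>A = 1 + p E(log Z)\<close> the entries of \<open>M - A\<close> are \<open>o(p)\<close>.  The function
  \<open>t powr (1/p)\<close> has a Lipschitz constant of order \<open>1/p\<close> near 1, so \<open>M powr (1/p)\<close> and \<open>A powr (1/p)\<close> have
  the same limit; the latter is computed eigenvalue by eigenvalue in a fixed eigenbasis.\<close>

theorem geo_mean_map_eq_exp_log: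
  assumes E: "positive_linear_map n m E" "unital_map n m E" and U: "unitary_mat n U"
    and z: "\<And>k. k < n \<Longrightarrow> 0 < z k"
    and V: "unitary_mat m V" and L: "E (udiag n U (\<lambda>k. ln (z k))) = udiag m V y"
  shows "geo_mean_map m E (udiag n U z) = udiag m V (\<lambda>l. exp (y l))"
proof -
  note cV = unitary_matD(1)[OF V]
  define R where "R = (\<Sum>k<n. \<bar>ln (z k)\<bar>)"
  have R0: "0 \<le> R" unfolding R_def by (intro sum_nonneg) auto
  have lnR: "\<bar>ln (z k)\<bar> \<le> R" if "k < n" for k
    unfolding R_def using that by (intro member_le_sum) auto
  have yR: "\<bar>y l\<bar> \<le> R" if "l < m" for l
    using eigenvalue_between[OF E U V L that] lnR by (smt (verit))
  define M where "M p = E (udiag n U (\<lambda>k. z k powr p))" for p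
  define A where "A p = udiag m V (\<lambda>l. 1 + p * y l)" for p
  define B where "B p = udiag m V (\<lambda>l. (1 + p * y l) powr (1 / p))" for p
  define X where "X p = power_mean_map E p (udiag n U z)" for p
  have cM: "M p \<in> carrier_mat m m" for p unfolding M_def by (rule positive_map_udiag_hermitian(1)[OF E(1) U])
  have cA: "A p \<in> carrier_mat m m" and cB: "B p \<in> carrier_mat m m" for p unfolding A_def B_def using cV by auto
  have XM: "X p = mat_fun (\<lambda>x. x powr (1 / p)) (M p)" for p
    unfolding X_def power_mean_map_def mat_fun_udiag[OF U] M_def ..

  \<comment> \<open>\<open>p < 1 / (R + 1)\<close> keeps the spectrum of \<open>A p\<close> positive; both spectra are bounded by \<open>exp (p * R)\<close>\<close>
  have bound: "frobenius_sq m (X p - B p) \<le> (exp R / p)\<^sup>2 * frobenius_sq m (M p - A p)"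
    and cX: "X p \<in> carrier_mat m m"
    if p: "0 < p" "p < 1 / (R + 1)" for p
  proof -
    have pR: "p * R < 1" "p \<le> 1" 
    proof -
      have "p * (R + 1) < 1" using p R0 by (simp add: field_simps)
      then show "p * R < 1" using p by (simp add: algebra_simps)
      have "1 / (R + 1) \<le> 1" using R0 by simp
      then show "p \<le> 1" using p by simp
    qed
    obtain W x where W: "unitary_mat m W" "M p = udiag m W x"
      using hermitian_diagonalisation[OF positive_map_udiag_hermitian[OF E(1) U]] unfolding M_def by blast
    have X: "X p = udiag m W (\<lambda>l. x l powr (1 / p))" unfolding XM W(2) by (rule mat_fun_udiag[OF W(1)])
    then show "X p \<in> carrier_mat m m" using unitary_matD(1)[OF W(1)] by simp
    have x: "0 < x l" "x l \<le> exp (p * R)" if l: "l < m" for l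
    proof -
      have eq: "E (udiag n U (\<lambda>k. z k powr p)) = udiag m W x" using W(2) unfolding M_def .
      obtain k where k: "k < n" "z k powr p \<le> x l"
        using eigenvalue_between(1)[OF E U W(1) eq l] by blast
      obtain k' where k': "k' < n" "x l \<le> z k' powr p"
        using eigenvalue_between(2)[OF E U W(1) eq l] by blast
      show "0 < x l" using k z[OF k(1)] by (smt (verit) powr_gt_zero)
      have "z k' powr p = exp (p * ln (z k'))" using z[OF k'(1)] by (simp add: powr_def)
      also have "\<dots> \<le> exp (p * R)" using lnR[OF k'(1)] p by (auto intro!: mult_left_mono)
      finally show "x l \<le> exp (p * R)" using k'(2) by simp
    qed
    have y: "0 < 1 + p * y l" "1 + p * y l \<le> exp (p * R)" if l: "l < m" for l
    proof -
      have "p * \<bar>y l\<bar> \<le> p * R" using yR[OF l] p by (intro mult_left_mono) auto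
      then have *: "\<bar>p * y l\<bar> \<le> p * R" using p by (simp add: abs_mult)
      then show "0 < 1 + p * y l" using pR by linarith
      have "1 + p * y l \<le> exp (p * y l)" by (rule exp_ge_add_one_self)
      also have "\<dots> \<le> exp (p * R)" using * by simp
      finally show "1 + p * y l \<le> exp (p * R)" .
    qed
    show "frobenius_sq m (X p - B p) \<le> (exp R / p)\<^sup>2 * frobenius_sq m (M p - A p)"
      unfolding X B_def W(2) A_def using p pR x y R0
      by (intro frobenius_sq_lipschitz[where g = "\<lambda>t. t powr (1 / p)", OF W(1) V] powr_inverse_lipschitz) auto
  qed

  have small: "((\<lambda>p. frobenius_sq m (M p - A p) / p\<^sup>2) \<longlongrightarrow> 0) (at_right 0)"
  proof -
    define P where "P k i j = E (eigenprojection n U k) $$ (i, j)" for k i j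
    define q where "q k p = (z k powr p - 1) / p - ln (z k)" for k p
    have entry: "(M p - A p) $$ (i, j) = of_real p * (\<Sum>k<n. of_real (q k p) * P k i j)"
      if ij: "i < m" "j < m" and p: "0 < p" for i j p
    proof -
      have M: "M p $$ (i, j) = (\<Sum>k<n. of_real (z k powr p) * P k i j)"
        unfolding M_def P_def by (rule linear_map_udiag_index[OF E(1) U ij])
      have one: "udiag m V (\<lambda>_. 1) $$ (i, j) = (\<Sum>k<n. P k i j)"
      proof -
        have "udiag m V (\<lambda>_. 1) = E (udiag n U (\<lambda>_. 1))"
          using E(2) unfolding unital_map_def udiag_const_one[OF U] udiag_const_one[OF V] by simp
        then show ?thesis unfolding P_def using linear_map_udiag_index[OF E(1) U ij, of "\<lambda>_. 1"] by simp
      qed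
      have log: "udiag m V y $$ (i, j) = (\<Sum>k<n. of_real (ln (z k)) * P k i j)"
        unfolding L[symmetric] P_def by (rule linear_map_udiag_index[OF E(1) U ij])
      have "A p = udiag m V (\<lambda>_. 1) + of_real p \<cdot>\<^sub>m udiag m V y"
        unfolding A_def udiag_smult[OF cV] udiag_add[OF cV] ..
      then have "A p $$ (i, j) = (\<Sum>k<n. P k i j) + of_real p * (\<Sum>k<n. of_real (ln (z k)) * P k i j)"
        using ij cV by (simp add: one log)
      then have "(M p - A p) $$ (i, j) = (\<Sum>k<n. of_real (z k powr p) * P k i j)
          - ((\<Sum>k<n. P k i j) + of_real p * (\<Sum>k<n. of_real (ln (z k)) * P k i j))"
        using cA[of p] ij M by simp
      also have "\<dots> = (\<Sum>k<n. of_real (p * q k p) * P k i j)"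
      proof -
        have pq: "p * q k p = z k powr p - 1 - p * ln (z k)" for k
          using p by (simp add: q_def field_simps)
        show ?thesis
          unfolding pq by (simp add: left_diff_distrib right_diff_distrib sum_subtractf sum_distrib_left mult_ac)
      qed
      finally show ?thesis by (simp add: sum_distrib_left mult_ac)
    qed
    have q0: "(q k \<longlongrightarrow> 0) (at_right 0)" if "k < n" for k
      using tendsto_diff[OF powr_difference_quotient[OF z[OF that]] tendsto_const[of "ln (z k)"]]
      unfolding q_def by simp
    have "((\<lambda>p. \<Sum>i<m. \<Sum>j<m. (cmod (\<Sum>k<n. of_real (q k p) * P k i j))\<^sup>2)
        \<longlongrightarrow> (\<Sum>i<m. \<Sum>j<m. (cmod (\<Sum>k<n. of_real 0 * P k i j))\<^sup>2)) (at_right 0)"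
      by (intro tendsto_intros q0) auto
    moreover have "eventually (\<lambda>p. (\<Sum>i<m. \<Sum>j<m. (cmod (\<Sum>k<n. of_real (q k p) * P k i j))\<^sup>2)
        = frobenius_sq m (M p - A p) / p\<^sup>2) (at_right 0)"
      using eventually_at_right_less[of 0]
    proof eventually_elim
      case (elim p)
      have "frobenius_sq m (M p - A p) = (\<Sum>i<m. \<Sum>j<m. p\<^sup>2 * (cmod (\<Sum>k<n. of_real (q k p) * P k i j))\<^sup>2)"
        unfolding frobenius_sq_def using elim
        by (intro sum.cong refl) (simp only: entry lessThan_iff norm_mult power_mult_distrib norm_of_real power2_abs)
      then show ?case using elim by (simp flip: sum_distrib_left)
    qed
    ultimately show ?thesis by (auto dest: Lim_transform_eventually)
  qed

  have XB: "((\<lambda>p. X p $$ (i, j) - B p $$ (i, j)) \<longlongrightarrow> 0) (at_right 0)" if ij: "i < m" "j < m" for i j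
  proof -
    have "((\<lambda>p. sqrt ((exp R)\<^sup>2 * (frobenius_sq m (M p - A p) / p\<^sup>2))) \<longlongrightarrow> sqrt ((exp R)\<^sup>2 * 0)) (at_right 0)"
      by (intro tendsto_intros small)
    moreover have "eventually (\<lambda>p. p < 1 / (R + 1)) (at_right 0)"
      using R0 by (intro order_tendstoD(2)[OF tendsto_ident_at]) auto
    then have "eventually (\<lambda>p. norm (X p $$ (i, j) - B p $$ (i, j))
        \<le> sqrt ((exp R)\<^sup>2 * (frobenius_sq m (M p - A p) / p\<^sup>2))) (at_right 0)"
      using eventually_at_right_less[of 0]
    proof eventually_elim
      case (elim p)
      have "(cmod ((X p - B p) $$ (i, j)))\<^sup>2 \<le> frobenius_sq m (X p - B p)"
        by (rule entry_sq_le_frobenius_sq[OF ij])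
      also have "\<dots> \<le> (exp R)\<^sup>2 * (frobenius_sq m (M p - A p) / p\<^sup>2)"
        using bound[of p] elim by (simp add: power_divide)
      finally show ?case using ij cB[of p] cX[of p] elim by (intro real_le_rsqrt) simp
    qed
    ultimately show ?thesis by (intro Lim_null_comparison[where f = "\<lambda>p. X p $$ (i, j) - B p $$ (i, j)"]) auto
  qed
  have B: "((\<lambda>p. B p $$ (i, j)) \<longlongrightarrow> udiag m V (\<lambda>l. exp (y l)) $$ (i, j)) (at_right 0)"
    if ij: "i < m" "j < m" for i j
  proof -
    have "((\<lambda>p. (1 + p * t) powr (1 / p)) \<longlongrightarrow> exp t) (at_right 0)" for t :: real
      using tendsto_exp_limit_at_right[of t] by (simp add: mult.commute)
    then show ?thesis unfolding B_def udiag_index[OF cV ij] by (intro tendsto_intros)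
  qed
  have "((\<lambda>p. X p $$ (i, j)) \<longlongrightarrow> udiag m V (\<lambda>l. exp (y l)) $$ (i, j)) (at_right 0)"
    if ij: "i < m" "j < m" for i j
    using tendsto_add[OF XB[OF ij] B[OF ij]] by simp
  then have "Lim (at_right 0) (\<lambda>p. X p $$ (i, j)) = udiag m V (\<lambda>l. exp (y l)) $$ (i, j)"
    if "i < m" "j < m" for i j
    using that by (intro tendsto_Lim) (auto simp: trivial_limit_at_right_real)
  then show ?thesis
    unfolding geo_mean_map_def X_def using cV by (intro eq_matI) auto
qed

section \<open>Jensen inequalities for positive linear maps\<close>

text \<open>The common part of the results for power means and for the geometric mean, which differ in \<open>\<psi>\<close> and in the
  domain \<open>T\<close> on which \<open>\<psi>\<close> is monotone.\<close>

lemma positive_map_jensen_comparison: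
  fixes f \<psi> :: "real \<Rightarrow> real"
  assumes E: "positive_linear_map n m E" and U: "unitary_mat n U"
    and W: "unitary_mat m W" "E (udiag n U \<alpha>) = udiag m W x"
      "\<And>i j. i \<le> j \<Longrightarrow> j < m \<Longrightarrow> f (\<psi> (x i)) \<le> f (\<psi> (x j))"
    and V: "unitary_mat m V" "E (udiag n U \<beta>) = udiag m V y"
      "\<And>i j. i \<le> j \<Longrightarrow> j < m \<Longrightarrow> y i \<le> y j" "\<And>l. l < m \<Longrightarrow> y l \<in> T"
    and \<psi>: "\<And>t. 0 \<le> \<psi> t" "\<And>s t. s \<in> T \<Longrightarrow> s \<le> t \<Longrightarrow> \<psi> s \<le> \<psi> t"
    and log_concave: "\<And>d :: nat \<Rightarrow> real. (\<And>l. l < m \<Longrightarrow> 0 < \<psi> (y l)) \<Longrightarrow> (\<And>l. 0 \<le> d l) \<Longrightarrow>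
      (\<Sum>l<m. d l) = 1 \<Longrightarrow> exp (\<Sum>l<m. d l * ln (\<psi> (y l))) \<le> \<psi> (\<Sum>l<m. d l * y l)"
    and jensen: "\<And>h. (\<Sum>i<m. (cmod (h i))\<^sup>2) = 1 \<Longrightarrow>
      (\<Sum>k<n. weight n m E U h k * \<alpha> k) \<in> T \<and>
      \<psi> (\<Sum>k<n. weight n m E U h k * \<alpha> k) \<in> \<Omega> \<and>
      \<psi> (\<Sum>k<n. weight n m E U h k * \<beta> k) \<le> f (\<psi> (\<Sum>k<n. weight n m E U h k * \<alpha> k))"
  shows "wlog_major m (udiag m W (\<lambda>i. f (\<psi> (x i)))) (udiag m V (\<lambda>i. \<psi> (y i))) \<and>
    (mono_on \<Omega> f \<or> antimono_on \<Omega> f \<longrightarrow> (\<exists>Q. unitary_mat m Q \<and>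
      loewner_le m (Q * udiag m V (\<lambda>i. \<psi> (y i)) * mat_adjoint Q) (udiag m W (\<lambda>i. f (\<psi> (x i))))))"
proof -
  define D where "D = {t \<in> T. \<psi> t \<in> \<Omega>}"
  have rayleigh: "(\<Sum>l<m. d l * (cmod (coord m Q h l))\<^sup>2) = (\<Sum>k<n. weight n m E U h k * a k)"
    if "unitary_mat m Q" "E (udiag n U a) = udiag m Q d" for Q d a h
    using qform_linear_map_udiag[OF E U, of a h] that(2) qform_udiag[OF unitary_matD(1)[OF that(1)], of d h]
    by (simp add: mult.commute)
  have \<psi>y: "\<psi> (y l) \<le> \<psi> t" if "l < m" "y l \<le> t" for l t using \<psi>(2) V(4) that by blast
  have le: "\<psi> (\<Sum>l<m. y l * (cmod (coord m V h l))\<^sup>2) \<le> f (\<psi> (\<Sum>l<m. x l * (cmod (coord m W h l))\<^sup>2))"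
    if "(\<Sum>i<m. (cmod (h i))\<^sup>2) = 1" for h
    unfolding rayleigh[OF W(1,2)] rayleigh[OF V(1,2)] using jensen[OF that] by blast
  have D: "(\<Sum>l<m. x l * (cmod (coord m W h l))\<^sup>2) \<in> D" if "(\<Sum>i<m. (cmod (h i))\<^sup>2) = 1" for h
    unfolding rayleigh[OF W(1,2)] D_def using jensen[OF that] by blast
  have mono: "mono_on D (\<lambda>t. f (\<psi> t)) \<or> antimono_on D (\<lambda>t. f (\<psi> t))"
    if "mono_on \<Omega> f \<or> antimono_on \<Omega> f"
    using that \<psi>(2) by (auto simp: monotone_on_def D_def)
  note comparison = jensen_spectral_comparison[where F = "\<lambda>t. f (\<psi> t)" and \<psi> = \<psi> and D = D,
      OF W(1) V(1)]
  show ?thesis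
  proof (intro conjI impI)
    show "wlog_major m (udiag m W (\<lambda>i. f (\<psi> (x i)))) (udiag m V (\<lambda>i. \<psi> (y i)))"
      by (rule comparison(1)) (fact W(3) V(3) \<psi>(1) \<psi>y log_concave le D)+
    assume f_mono: "mono_on \<Omega> f \<or> antimono_on \<Omega> f"
    show "\<exists>Q. unitary_mat m Q \<and>
      loewner_le m (Q * udiag m V (\<lambda>i. \<psi> (y i)) * mat_adjoint Q) (udiag m W (\<lambda>i. f (\<psi> (x i))))"
      by (rule comparison(2)) (fact W(3) V(3) \<psi>(1) \<psi>y log_concave le D mono[OF f_mono])+
  qed
qed

lemma power_mean_comparison:
  assumes E: "positive_linear_map n m E" "sub_unital_map n m E"
    and \<Omega>: "is_interval \<Omega>" "\<Omega> \<subseteq> {0..}" "\<not> unital_map n m E \<longrightarrow> 0 \<in> \<Omega>"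
    and f: "doubly_concave_on \<Omega> f" and Z: "Z \<in> hermitian_mats n \<Omega>" and p: "0 < p" "p \<le> 1"
  shows "wlog_major m (mat_fun f (power_mean_map E p Z)) (power_mean_map E p (mat_fun f Z)) \<and>
    (mono_on \<Omega> f \<or> antimono_on \<Omega> f \<longrightarrow> (\<exists>V. unitary_mat m V \<and>
      loewner_le m (V * power_mean_map E p (mat_fun f Z) * mat_adjoint V) (mat_fun f (power_mean_map E p Z))))"
proof -
  obtain U z where U: "unitary_mat n U" "Z = udiag n U z" "\<And>k. k < n \<Longrightarrow> z k \<in> \<Omega>"
    using hermitian_mats_diagonalisation[OF Z] by blast
  let ?\<psi> = "\<lambda>t :: real. t powr (1 / p)"
  obtain W x where W: "unitary_mat m W" "E (udiag n U (\<lambda>k. z k powr p)) = udiag m W x"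
    "\<And>i j. i \<le> j \<Longrightarrow> j < m \<Longrightarrow> f (?\<psi> (x i)) \<le> f (?\<psi> (x j))"
    using hermitian_diagonalisation_sorted[where key = "\<lambda>t. f (?\<psi> t)",
        OF positive_map_udiag_hermitian[OF E(1) U(1)]] by blast
  obtain V y where V: "unitary_mat m V" "E (udiag n U (\<lambda>k. f (z k) powr p)) = udiag m V y"
    "\<And>i j. i \<le> j \<Longrightarrow> j < m \<Longrightarrow> y i \<le> y j"
    using hermitian_diagonalisation_sorted[where key = "\<lambda>t. t",
        OF positive_map_udiag_hermitian[OF E(1) U(1)]] by blast
  \<comment> \<open>positivity of \<open>E\<close> places the eigenvalues of \<open>Y\<close> in the half-line on which \<open>\<psi>\<close> is monotone\<close>
  have "udiag n U (\<lambda>k. f (z k) powr p) \<in> psd_mats n" unfolding udiag_in_hermitian_mats_iff[OF U(1)] by simp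
  then have "udiag m V y \<in> psd_mats m" unfolding V(2)[symmetric] by (rule positive_linear_mapD(4)[OF E(1)])
  then have y0: "y l \<in> {0..}" if "l < m" for l unfolding udiag_in_hermitian_mats_iff[OF V(1)] using that by blast
  have jensen: "(\<Sum>k<n. weight n m E U h k * z k powr p) \<in> {0..} \<and>
      ?\<psi> (\<Sum>k<n. weight n m E U h k * z k powr p) \<in> \<Omega> \<and>
      ?\<psi> (\<Sum>k<n. weight n m E U h k * f (z k) powr p) \<le> f (?\<psi> (\<Sum>k<n. weight n m E U h k * z k powr p))"
    if h: "(\<Sum>i<m. (cmod (h i))\<^sup>2) = 1" for h
  proof -
    have w: "0 \<le> weight n m E U h k" for k by (rule weight_nonneg[OF E(1) U(1)])
    have le: "(\<Sum>k<n. weight n m E U h k) \<le> 1" using sum_weight_sub_unital[OF E U(1), of h] h by simp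
    have sub: "(\<Sum>k<n. weight n m E U h k) = 1 \<or> 0 \<in> \<Omega>"
      using sum_weight_unital[OF E(1) _ U(1), of h] h \<Omega>(3) by auto
    have zI: "\<And>k. k \<in> {..<n} \<Longrightarrow> z k \<in> \<Omega>" using U(3) by simp
    note J = sub_unital_power_mean_jensen[where w = "weight n m E U h" and z = z,
        OF f \<Omega>(1,2) p finite_lessThan w le zI sub]
    have "0 \<le> (\<Sum>k<n. weight n m E U h k * z k powr p)" using w by (intro sum_nonneg) auto
    then show ?thesis using J by auto
  qed
  have log_concave: "exp (\<Sum>l<m. d l * ln (?\<psi> (y l))) \<le> ?\<psi> (\<Sum>l<m. d l * y l)"
    if pos: "\<And>l. l < m \<Longrightarrow> 0 < ?\<psi> (y l)" and d: "\<And>l. 0 \<le> d l" "(\<Sum>l<m. d l) = 1" for d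
  proof -
    have y: "0 < y l" if "l < m" for l using pos[OF that] y0[OF that] by (cases "y l = 0") auto
    have ne: "{..<m} \<noteq> {}" using d(2) by auto
    have "(\<Sum>l<m. d l * ln (y l)) \<le> ln (\<Sum>l<m. d l * y l)"
      using concave_on_sum[where f = ln and C = "{0<..}" and a = d and y = y, OF finite_lessThan ne ln_concave d(2) d(1)] y
      by simp
    moreover have "0 < (\<Sum>l<m. d l * y l)"
      using convex_sum[where C = "{0<..}" and a = d and y = y, OF finite_lessThan convex_real_interval(3) d(2) d(1)] y by simp
    ultimately have "exp (1 / p * (\<Sum>l<m. d l * ln (y l))) \<le> ?\<psi> (\<Sum>l<m. d l * y l)"
      using p by (auto simp: powr_def intro!: divide_right_mono)
    moreover have "(\<Sum>l<m. d l * ln (?\<psi> (y l))) = 1 / p * (\<Sum>l<m. d l * ln (y l))"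
      unfolding sum_distrib_left using y by (intro sum.cong refl) (simp add: ln_powr)
    ultimately show ?thesis by simp
  qed
  have X: "mat_fun f (power_mean_map E p Z) = udiag m W (\<lambda>i. f (?\<psi> (x i)))"
    unfolding power_mean_map_def U(2) mat_fun_udiag[OF U(1)] W(2) mat_fun_udiag[OF W(1)] ..
  have Y: "power_mean_map E p (mat_fun f Z) = udiag m V (\<lambda>i. ?\<psi> (y i))"
    unfolding power_mean_map_def U(2) mat_fun_udiag[OF U(1)] V(2) mat_fun_udiag[OF V(1)] ..
  have \<psi>: "?\<psi> s \<le> ?\<psi> t" if "s \<in> {0..}" "s \<le> t" for s t using that p by (intro powr_mono2) auto
  show ?thesis
    unfolding X Y
    by (rule positive_map_jensen_comparison[where \<psi> = ?\<psi> and T = "{0..}", OF E(1) U(1) W(1,2) _ V(1,2)])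
      (fact W V y0 powr_ge_zero \<psi> log_concave jensen)+
qed

lemma geo_mean_comparison:
  assumes E: "positive_linear_map n m E" "unital_map n m E"
    and \<Omega>: "is_interval \<Omega>" "\<Omega> \<subseteq> {0..}"
    and f: "doubly_concave_on \<Omega> f" and Z: "Z \<in> hermitian_mats n \<Omega>"
    and inv: "invertible_mat Z" "invertible_mat (mat_fun f Z)"
  shows "wlog_major m (mat_fun f (geo_mean_map m E Z)) (geo_mean_map m E (mat_fun f Z)) \<and>
    (mono_on \<Omega> f \<or> antimono_on \<Omega> f \<longrightarrow> (\<exists>V. unitary_mat m V \<and>
      loewner_le m (V * geo_mean_map m E (mat_fun f Z) * mat_adjoint V) (mat_fun f (geo_mean_map m E Z))))"
proof -
  obtain U z where U: "unitary_mat n U" "Z = udiag n U z" "\<And>k. k < n \<Longrightarrow> z k \<in> \<Omega>"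
    using hermitian_mats_diagonalisation[OF Z] by blast
  have fZ: "mat_fun f Z = udiag n U (\<lambda>k. f (z k))" unfolding U(2) by (rule mat_fun_udiag[OF U(1)])
  have z: "0 < z k" if "k < n" for k
    using invertible_udiag_nonzero[OF U(1) inv(1)[unfolded U(2)] that] U(3)[OF that] \<Omega>(2) by force
  have fz: "0 < f (z k)" if "k < n" for k
    using invertible_udiag_nonzero[OF U(1) inv(2)[unfolded fZ] that] doubly_concave_onD(1)[OF f U(3)[OF that]] by simp
  obtain W x where W: "unitary_mat m W" "E (udiag n U (\<lambda>k. ln (z k))) = udiag m W x"
    "\<And>i j. i \<le> j \<Longrightarrow> j < m \<Longrightarrow> f (exp (x i)) \<le> f (exp (x j))"
    using hermitian_diagonalisation_sorted[where key = "\<lambda>t. f (exp t)",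
        OF positive_map_udiag_hermitian[OF E(1) U(1)]] by blast
  obtain V y where V: "unitary_mat m V" "E (udiag n U (\<lambda>k. ln (f (z k)))) = udiag m V y"
    "\<And>i j. i \<le> j \<Longrightarrow> j < m \<Longrightarrow> y i \<le> y j"
    using hermitian_diagonalisation_sorted[where key = "\<lambda>t. t",
        OF positive_map_udiag_hermitian[OF E(1) U(1)]] by blast
  have jensen: "(\<Sum>k<n. weight n m E U h k * ln (z k)) \<in> UNIV \<and>
      exp (\<Sum>k<n. weight n m E U h k * ln (z k)) \<in> \<Omega> \<and>
      exp (\<Sum>k<n. weight n m E U h k * ln (f (z k))) \<le> f (exp (\<Sum>k<n. weight n m E U h k * ln (z k)))"
    if h: "(\<Sum>i<m. (cmod (h i))\<^sup>2) = 1" for h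
  proof -
    have w: "0 \<le> weight n m E U h k" for k by (rule weight_nonneg[OF E(1) U(1)])
    have one: "(\<Sum>k<n. weight n m E U h k) = 1" using sum_weight_unital[OF E U(1), of h] h by simp
    show ?thesis
      using doubly_concave_geometric_mean[where w = "weight n m E U h" and z = z and I = "{..<n}",
          OF f \<Omega>(1) finite_lessThan w one] U(3) z fz by simp
  qed
  have "geo_mean_map m E Z = udiag m W (\<lambda>i. exp (x i))"
    unfolding U(2) by (rule geo_mean_map_eq_exp_log[OF E U(1) z W(1,2)])
  then have X: "mat_fun f (geo_mean_map m E Z) = udiag m W (\<lambda>i. f (exp (x i)))"
    using mat_fun_udiag[OF W(1)] by simp
  have Y: "geo_mean_map m E (mat_fun f Z) = udiag m V (\<lambda>i. exp (y i))"
    unfolding fZ by (rule geo_mean_map_eq_exp_log[OF E U(1) fz V(1,2)])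
  show ?thesis
    unfolding X Y
    by (rule positive_map_jensen_comparison[where \<psi> = exp and T = UNIV, OF E(1) U(1) W(1,2) _ V(1,2)])
      ((fact W V jensen)+ | simp)+
qed

theorem theorem2p7:
  fixes n m :: nat and E :: "complex mat \<Rightarrow> complex mat" and f :: "real \<Rightarrow> real"
    and \<Omega> :: "real set" and Z :: "complex mat" and p :: real
  assumes "positive_linear_map n m E" and "sub_unital_map n m E"
    and "is_interval \<Omega>" and "\<Omega> \<subseteq> {0..}"
    and "\<not> unital_map n m E \<longrightarrow> 0 \<in> \<Omega>"
    and "doubly_concave_on \<Omega> f"
    and "Z \<in> hermitian_mats n \<Omega>"
    and "0 < p" and "p \<le> 1"
  shows
    "wlog_major m (mat_fun f (power_mean_map E p Z)) (power_mean_map E p (mat_fun f Z)) \<and>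
     (mono_on \<Omega> f \<or> antimono_on \<Omega> f \<longrightarrow>
       (\<exists>V. unitary_mat m V \<and>
         loewner_le m (V * power_mean_map E p (mat_fun f Z) * mat_adjoint V)
           (mat_fun f (power_mean_map E p Z)))) \<and>
     (unital_map n m E \<and> invertible_mat Z \<and> invertible_mat (mat_fun f Z) \<longrightarrow>
       wlog_major m (mat_fun f (geo_mean_map m E Z)) (geo_mean_map m E (mat_fun f Z)) \<and>
       (mono_on \<Omega> f \<or> antimono_on \<Omega> f \<longrightarrow>
         (\<exists>V. unitary_mat m V \<and>
           loewner_le m (V * geo_mean_map m E (mat_fun f Z) * mat_adjoint V)
             (mat_fun f (geo_mean_map m E Z)))))"
  using power_mean_comparison[OF assms(1-9)] geo_mean_comparison[OF assms(1) _ assms(3,4,6,7)] by blast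

end
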